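(* Let $A\in\mathcal{V}$ and let $\theta$ be a congruence of $A$ with $\theta\subseteq Rad(A)$ such that $\theta$ has $CBLP$. If $A/\theta$ is $B$-normal, then $A$ is $B$-normal.
   Context: $\mathcal{V}$ is a congruence modular, semidegenerate variety (no nontrivial algebra has a one-element subalgebra) of finite signature. For $B\in\mathcal{V}$: $Con(B)$ is its congruence lattice with bounds $\Delta_B,\nabla_B$, $[\cdot,\cdot]$ the Freese–McKenzie commutator, $K(B)$ the compact congruences. A congruence $\phi\neq\nabla_B$ is prime if $[\alpha,\beta]\subseteq\phi$ implies $\alpha\subseteq\phi$ or $\beta\subseteq\phi$; $\rho(\theta)$ is the intersection of primes containing $\theta$; $Rad(B)$ is the intersection of all maximal congruences of $B$. $B(Con(B))$ is the Boolean algebra of complemented elements of $Con(B)$. When $K(B)$ is closed under the commutator, the reticulation $L(B)=K(B)/{\equiv}$ ($\alpha\equiv\beta$ iff $\rho(\alpha)=\rho(\beta)$) is a bounded distributive lattice with canonical map $\lambda_B$, mapping $B(Con(B))$ injectively into $B(L(B))$; the reticulation preserves the Boolean center if this map is onto $B(L(B))$. Standing assumption: for every $B\in\mathcal{V}$, $K(B)$ is closed under the commutator and the reticulation of $B$ preserves the Boolean center. A congruence $\theta$ of $A$ has $CBLP$ if for every $\beta\in B(Con(A/\theta))$ there is $\alpha\in B(Con(A))$ with $(\alpha\vee\theta)/\theta=\beta$. An algebra $B\in\mathcal{V}$ is $B$-normal if for all $\chi,\varepsilon\in Con(B)$ with $\chi\vee\varepsilon=\nabla_B$ there exist $\alpha,\beta\in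 B(Con(B))$ with $\chi\vee\alpha=\varepsilon\vee\beta=\nabla_B$ and $[\alpha,\beta]=\Delta_B$. *)

theory Defs
  imports Main
begin

text \<open>A signature is a finite type of operation symbols 'f together with an arity
  function ar. An algebra is a pair (carrier, interpretation).\<close>

type_synonym ('a,'f) alg = "'a set \<times> ('f \<Rightarrow> 'a list \<Rightarrow> 'a)"

definition univ :: "('a,'f) alg \<Rightarrow> 'a set" where "univ B = fst B"
definition opr :: "('a,'f) alg \<Rightarrow> 'f \<Rightarrow> 'a list \<Rightarrow> 'a" where "opr B = snd B"

definition algebra :: "('f \<Rightarrow> nat) \<Rightarrow> ('a,'f) alg \<Rightarrow> bool" where
  "algebra ar B \<longleftrightarrow> univ B \<noteq> {} \<and>
     (\<forall>f xs. length xs = ar f \<and> set xs \<subseteq> univ B \<longrightarrow> opr B f xs \<in> univ B)"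

datatype ('f,'v) trm = Var 'v | App 'f "('f,'v) trm list"

fun wf_trm :: "('f \<Rightarrow> nat) \<Rightarrow> ('f,'v) trm \<Rightarrow> bool" where
  "wf_trm ar (Var v) = True"
| "wf_trm ar (App f ts) = (length ts = ar f \<and> (\<forall>t\<in>set ts. wf_trm ar t))"

fun eval :: "('a,'f) alg \<Rightarrow> ('v \<Rightarrow> 'a) \<Rightarrow> ('f,'v) trm \<Rightarrow> 'a" where
  "eval B \<sigma> (Var v) = \<sigma> v"
| "eval B \<sigma> (App f ts) = opr B f (map (eval B \<sigma>) ts)"

text \<open>The variety V is the class of models of a set of identities \<Sigma>.\<close>

definition models :: "('f \<Rightarrow> nat) \<Rightarrow> (('f,nat) trm \<times> ('f,nat) trm) set \<Rightarrow> ('a,'f) alg \<Rightarrow> bool" where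
  "models ar \<Sigma> B \<longleftrightarrow> algebra ar B \<and>
     (\<forall>(s,t)\<in>\<Sigma>. \<forall>\<sigma>. range \<sigma> \<subseteq> univ B \<longrightarrow> eval B \<sigma> s = eval B \<sigma> t)"

definition wf_ids :: "('f \<Rightarrow> nat) \<Rightarrow> (('f,nat) trm \<times> ('f,nat) trm) set \<Rightarrow> bool" where
  "wf_ids ar \<Sigma> \<longleftrightarrow> (\<forall>(s,t)\<in>\<Sigma>. wf_trm ar s \<and> wf_trm ar t)"

definition is_cong :: "('f \<Rightarrow> nat) \<Rightarrow> ('a,'f) alg \<Rightarrow> ('a \<times> 'a) set \<Rightarrow> bool" where
  "is_cong ar B \<theta> \<longleftrightarrow> equiv (univ B) \<theta> \<and>
     (\<forall>f xs ys. length xs = ar f \<and> length ys = ar f \<and>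
        (\<forall>i<ar f. (xs ! i, ys ! i) \<in> \<theta>) \<longrightarrow> (opr B f xs, opr B f ys) \<in> \<theta>)"

definition Con :: "('f \<Rightarrow> nat) \<Rightarrow> ('a,'f) alg \<Rightarrow> ('a \<times> 'a) set set" where
  "Con ar B = {\<theta>. is_cong ar B \<theta>}"

definition Delta :: "('a,'f) alg \<Rightarrow> ('a \<times> 'a) set" where "Delta B = Id_on (univ B)"
definition Nabla :: "('a,'f) alg \<Rightarrow> ('a \<times> 'a) set" where "Nabla B = univ B \<times> univ B"

definition Cg :: "('f \<Rightarrow> nat) \<Rightarrow> ('a,'f) alg \<Rightarrow> ('a \<times> 'a) set \<Rightarrow> ('a \<times> 'a) set" where
  "Cg ar B R = Nabla B \<inter> \<Inter>{\<gamma>\<in>Con ar B. R \<subseteq> \<gamma>}"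

definition cjoin :: "('f \<Rightarrow> nat) \<Rightarrow> ('a,'f) alg \<Rightarrow> ('a \<times> 'a) set \<Rightarrow> ('a \<times> 'a) set \<Rightarrow> ('a \<times> 'a) set" where
  "cjoin ar B \<alpha> \<beta> = Cg ar B (\<alpha> \<union> \<beta>)"

definition Kc :: "('f \<Rightarrow> nat) \<Rightarrow> ('a,'f) alg \<Rightarrow> ('a \<times> 'a) set set" where
  "Kc ar B = {\<alpha>\<in>Con ar B. \<forall>S\<subseteq>Con ar B. \<alpha> \<subseteq> Cg ar B (\<Union>S) \<longrightarrow>
                 (\<exists>S'\<subseteq>S. finite S' \<and> \<alpha> \<subseteq> Cg ar B (\<Union>S'))}"

definition centralizes :: "('f \<Rightarrow> nat) \<Rightarrow> ('a,'f) alg \<Rightarrow> ('a \<times> 'a) set \<Rightarrow> ('a \<times> 'a) set \<Rightarrow> ('a \<times> 'a) set \<Rightarrow> bool" where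
  "centralizes ar B \<alpha> \<beta> \<delta> \<longleftrightarrow>
     (\<forall>t::('f,nat) trm. \<forall>a b c d. wf_trm ar t \<and> (a,b) \<in> \<alpha> \<and> (\<forall>i. (c i, d i) \<in> \<beta>) \<longrightarrow>
        (eval B (case_nat a c) t, eval B (case_nat a d) t) \<in> \<delta> \<longrightarrow>
        (eval B (case_nat b c) t, eval B (case_nat b d) t) \<in> \<delta>)"

definition comm :: "('f \<Rightarrow> nat) \<Rightarrow> ('a,'f) alg \<Rightarrow> ('a \<times> 'a) set \<Rightarrow> ('a \<times> 'a) set \<Rightarrow> ('a \<times> 'a) set" where
  "comm ar B \<alpha> \<beta> = Nabla B \<inter> \<Inter>{\<delta>\<in>Con ar B. centralizes ar B \<alpha> \<beta> \<delta>}"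

definition prime_cong :: "('f \<Rightarrow> nat) \<Rightarrow> ('a,'f) alg \<Rightarrow> ('a \<times> 'a) set \<Rightarrow> bool" where
  "prime_cong ar B \<phi> \<longleftrightarrow> \<phi> \<in> Con ar B \<and> \<phi> \<noteq> Nabla B \<and>
     (\<forall>\<alpha>\<in>Con ar B. \<forall>\<beta>\<in>Con ar B. comm ar B \<alpha> \<beta> \<subseteq> \<phi> \<longrightarrow> \<alpha> \<subseteq> \<phi> \<or> \<beta> \<subseteq> \<phi>)"

definition rho :: "('f \<Rightarrow> nat) \<Rightarrow> ('a,'f) alg \<Rightarrow> ('a \<times> 'a) set \<Rightarrow> ('a \<times> 'a) set" where
  "rho ar B \<theta> = Nabla B \<inter> \<Inter>{\<phi>. prime_cong ar B \<phi> \<and> \<theta> \<subseteq> \<phi>}"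

definition max_cong :: "('f \<Rightarrow> nat) \<Rightarrow> ('a,'f) alg \<Rightarrow> ('a \<times> 'a) set \<Rightarrow> bool" where
  "max_cong ar B \<phi> \<longleftrightarrow> \<phi> \<in> Con ar B \<and> \<phi> \<noteq> Nabla B \<and>
     (\<forall>\<psi>\<in>Con ar B. \<phi> \<subseteq> \<psi> \<longrightarrow> \<psi> = \<phi> \<or> \<psi> = Nabla B)"

definition Rad :: "('f \<Rightarrow> nat) \<Rightarrow> ('a,'f) alg \<Rightarrow> ('a \<times> 'a) set" where
  "Rad ar B = Nabla B \<inter> \<Inter>{\<phi>. max_cong ar B \<phi>}"

definition BCon :: "('f \<Rightarrow> nat) \<Rightarrow> ('a,'f) alg \<Rightarrow> ('a \<times> 'a) set set" where
  "BCon ar B = {\<alpha>\<in>Con ar B. \<exists>\<gamma>\<in>Con ar B. cjoin ar B \<alpha> \<gamma> = Nabla B \<and> \<alpha> \<inter> \<gamma> = Delta B}"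

text \<open>In L(B) = K(B)/\<equiv> the class of \<alpha> is determined by rho(\<alpha>); the lattice operations are
  [\<alpha>] \<or> [\<beta>] = [\<alpha> \<or> \<beta>], [\<alpha>] \<and> [\<beta>] = [[\<alpha>,\<beta>]], 0 = [\<Delta>], 1 = [\<nabla>].
  The class of \<gamma> \<in> K(B) is in B(L(B)) iff it has a complement in L(B).
  The reticulation preserves the Boolean center iff every element of B(L(B)) is
  lambda_B(\<alpha>) = [\<alpha>] for some \<alpha> \<in> B(Con(B)).\<close>
definition ret_boolean :: "('f \<Rightarrow> nat) \<Rightarrow> ('a,'f) alg \<Rightarrow> ('a \<times> 'a) set \<Rightarrow> bool" where
  "ret_boolean ar B \<gamma> \<longleftrightarrow> \<gamma> \<in> Kc ar B \<and>
     (\<exists>\<delta>\<in>Kc ar B. rho ar B (cjoin ar B \<gamma> \<delta>) = rho ar B (Nabla B) \<and>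
                  rho ar B (comm ar B \<gamma> \<delta>) = rho ar B (Delta B))"

definition ret_preserves_BC :: "('f \<Rightarrow> nat) \<Rightarrow> ('a,'f) alg \<Rightarrow> bool" where
  "ret_preserves_BC ar B \<longleftrightarrow>
     (\<forall>\<gamma>. ret_boolean ar B \<gamma> \<longrightarrow> (\<exists>\<alpha>\<in>BCon ar B. rho ar B \<alpha> = rho ar B \<gamma>))"

definition cong_modular :: "('f \<Rightarrow> nat) \<Rightarrow> ('a,'f) alg \<Rightarrow> bool" where
  "cong_modular ar B \<longleftrightarrow> (\<forall>\<alpha>\<in>Con ar B. \<forall>\<beta>\<in>Con ar B. \<forall>\<gamma>\<in>Con ar B.
     \<alpha> \<subseteq> \<gamma> \<longrightarrow> cjoin ar B \<alpha> (\<beta> \<inter> \<gamma>) = cjoin ar B \<alpha> \<beta> \<inter> \<gamma>)"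

definition semidegenerate_alg :: "('f \<Rightarrow> nat) \<Rightarrow> ('a,'f) alg \<Rightarrow> bool" where
  "semidegenerate_alg ar B \<longleftrightarrow> (\<exists>x\<in>univ B. \<exists>y\<in>univ B. x \<noteq> y) \<longrightarrow>
     \<not> (\<exists>e\<in>univ B. \<forall>f. opr B f (replicate (ar f) e) = e)"

definition V_member_ok :: "('f \<Rightarrow> nat) \<Rightarrow> ('a,'f) alg \<Rightarrow> bool" where
  "V_member_ok ar B \<longleftrightarrow> cong_modular ar B \<and> semidegenerate_alg ar B \<and>
     (\<forall>\<alpha>\<in>Kc ar B. \<forall>\<beta>\<in>Kc ar B. comm ar B \<alpha> \<beta> \<in> Kc ar B) \<and>
     ret_preserves_BC ar B"

definition quot :: "('a,'f) alg \<Rightarrow> ('a \<times> 'a) set \<Rightarrow> ('a set,'f) alg" where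
  "quot B \<theta> = (univ B // \<theta>, \<lambda>f Xs. \<theta> `` {opr B f (map (\<lambda>X. SOME x. x \<in> X) Xs)})"

text \<open>For \<alpha> \<supseteq> \<theta>, the congruence \<alpha>/\<theta> of B/\<theta>.\<close>
definition qcong :: "('a \<times> 'a) set \<Rightarrow> ('a \<times> 'a) set \<Rightarrow> ('a set \<times> 'a set) set" where
  "qcong \<theta> \<alpha> = {(\<theta> `` {x}, \<theta> `` {y}) | x y. (x,y) \<in> \<alpha>}"

definition CBLP :: "('f \<Rightarrow> nat) \<Rightarrow> ('a,'f) alg \<Rightarrow> ('a \<times> 'a) set \<Rightarrow> bool" where
  "CBLP ar A \<theta> \<longleftrightarrow> (\<forall>\<beta>\<in>BCon ar (quot A \<theta>). \<exists>\<alpha>\<in>BCon ar A. qcong \<theta> (cjoin ar A \<alpha> \<theta>) = \<beta>)"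

definition B_normal :: "('f \<Rightarrow> nat) \<Rightarrow> ('a,'f) alg \<Rightarrow> bool" where
  "B_normal ar B \<longleftrightarrow> (\<forall>\<chi>\<in>Con ar B. \<forall>\<epsilon>\<in>Con ar B. cjoin ar B \<chi> \<epsilon> = Nabla B \<longrightarrow>
     (\<exists>\<alpha>\<in>BCon ar B. \<exists>\<beta>\<in>BCon ar B. cjoin ar B \<chi> \<alpha> = Nabla B \<and> cjoin ar B \<epsilon> \<beta> = Nabla B \<and>
        comm ar B \<alpha> \<beta> = Delta B))"

end

theory Submission
  imports Defs
begin

text \<open>Let \<open>\<chi> \<or> \<epsilon> = \<nabla>\<close>. B-normality of \<open>A/\<theta>\<close> and CBLP give complemented \<open>\<alpha>\<^sub>1, \<alpha>\<^sub>2\<close> of \<open>A\<close>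
  with \<open>\<chi> \<or> \<theta> \<or> \<alpha>\<^sub>1 = \<epsilon> \<or> \<theta> \<or> \<alpha>\<^sub>2 = \<nabla>\<close> such that \<open>\<alpha>\<^sub>1 \<or> \<theta>\<close> centralizes \<open>\<alpha>\<^sub>2 \<or> \<theta>\<close> modulo \<open>\<theta>\<close>.
  The required pair is \<open>\<alpha>\<^sub>1\<close> and a complement \<open>\<gamma>\<^sub>1\<close> of it, so that the commutator vanishes because the
  meet does. By semidegeneracy and finiteness of the signature every proper congruence lies below a
  maximal one, which contains \<open>\<theta>\<close>; hence \<open>\<chi> \<or> \<alpha>\<^sub>1 = \<nabla>\<close>. If \<open>\<epsilon> \<or> \<gamma>\<^sub>1 \<noteq> \<nabla>\<close>, a maximal \<open>\<phi>\<close> above it contains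
  neither \<open>\<alpha>\<^sub>1\<close> nor \<open>\<alpha>\<^sub>2\<close>. The Shifting Lemma, applied in the subalgebra \<open>\<beta>\<close> of \<open>A \<times> A\<close>, shows that
  centrality passes to larger \<open>\<delta>\<close> and is symmetric; so \<open>\<nabla>\<close> centralizes \<open>\<nabla>\<close> modulo \<open>\<phi>\<close>. Then
  collapsing the diagonal of \<open>A \<times> A\<close> yields a nontrivial algebra of the variety with a one-element
  subalgebra, contrary to semidegeneracy.\<close>

section \<open>Congruences and term evaluation\<close>

lemma ConD:
  assumes "\<theta> \<in> Con ar B"
  shows Con_subset: "\<theta> \<subseteq> univ B \<times> univ B"
    and Con_refl: "\<And>x. x \<in> univ B \<Longrightarrow> (x,x) \<in> \<theta>"
    and Con_sym: "\<And>x y. (x,y) \<in> \<theta> \<Longrightarrow> (y,x) \<in> \<theta>"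
    and Con_trans: "\<And>x y z. (x,y) \<in> \<theta> \<Longrightarrow> (y,z) \<in> \<theta> \<Longrightarrow> (x,z) \<in> \<theta>"
    and Con_opr: "\<And>f xs ys. length xs = ar f \<Longrightarrow> length ys = ar f \<Longrightarrow>
      (\<And>i. i < ar f \<Longrightarrow> (xs ! i, ys ! i) \<in> \<theta>) \<Longrightarrow> (opr B f xs, opr B f ys) \<in> \<theta>"
proof -
  have e: "equiv (univ B) \<theta>" and c: "is_cong ar B \<theta>"
    using assms by (auto simp: Con_def is_cong_def)
  show "\<theta> \<subseteq> univ B \<times> univ B" using e by (rule equiv_type)
  show "\<And>x. x \<in> univ B \<Longrightarrow> (x,x) \<in> \<theta>" using e by (auto simp: equiv_def refl_on_def)
  show "\<And>x y. (x,y) \<in> \<theta> \<Longrightarrow> (y,x) \<in> \<theta>" using e by (auto simp: equiv_def dest: symD)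
  show "\<And>x y z. (x,y) \<in> \<theta> \<Longrightarrow> (y,z) \<in> \<theta> \<Longrightarrow> (x,z) \<in> \<theta>" using e by (auto simp: equiv_def dest: transD)
  show "\<And>f xs ys. length xs = ar f \<Longrightarrow> length ys = ar f \<Longrightarrow>
      (\<And>i. i < ar f \<Longrightarrow> (xs ! i, ys ! i) \<in> \<theta>) \<Longrightarrow> (opr B f xs, opr B f ys) \<in> \<theta>"
    using c unfolding is_cong_def by blast
qed

lemma ConI:
  assumes "\<theta> \<subseteq> univ B \<times> univ B" "\<And>x. x \<in> univ B \<Longrightarrow> (x,x) \<in> \<theta>"
    "\<And>x y. (x,y) \<in> \<theta> \<Longrightarrow> (y,x) \<in> \<theta>" "\<And>x y z. (x,y) \<in> \<theta> \<Longrightarrow> (y,z) \<in> \<theta> \<Longrightarrow> (x,z) \<in> \<theta>"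
    "\<And>f xs ys. length xs = ar f \<Longrightarrow> length ys = ar f \<Longrightarrow>
      (\<And>i. i < ar f \<Longrightarrow> (xs ! i, ys ! i) \<in> \<theta>) \<Longrightarrow> (opr B f xs, opr B f ys) \<in> \<theta>"
  shows "\<theta> \<in> Con ar B"
proof -
  have "equiv (univ B) \<theta>"
    unfolding equiv_def refl_on_def sym_def trans_def using assms(1-4) by blast
  then show ?thesis using assms(5) unfolding Con_def is_cong_def by blast
qed

lemma algebra_opr:
  "algebra ar B \<Longrightarrow> length xs = ar f \<Longrightarrow> set xs \<subseteq> univ B \<Longrightarrow> opr B f xs \<in> univ B"
  by (auto simp: algebra_def)

lemma Nabla_Con: "algebra ar B \<Longrightarrow> Nabla B \<in> Con ar B"
  by (rule ConI) (auto simp: Nabla_def in_set_conv_nth subset_iff intro!: algebra_opr)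

lemma Delta_Con: "algebra ar B \<Longrightarrow> Delta B \<in> Con ar B"
proof (rule ConI)
  fix f xs ys
  assume alg: "algebra ar B" and l: "length xs = ar f" "length ys = ar f"
    and R: "\<And>i. i < ar f \<Longrightarrow> (xs ! i, ys ! i) \<in> Delta B"
  then have "xs = ys" by (auto simp: Delta_def Id_on_iff intro!: nth_equalityI)
  moreover have "set xs \<subseteq> univ B"
    using l R by (fastforce simp: Delta_def in_set_conv_nth Id_on_iff)
  ultimately show "(opr B f xs, opr B f ys) \<in> Delta B"
    using alg l by (auto simp: Delta_def intro: algebra_opr)
qed (auto simp: Delta_def)

lemma Int_Con:
  assumes "\<alpha> \<in> Con ar B" "\<beta> \<in> Con ar B"
  shows "\<alpha> \<inter> \<beta> \<in> Con ar B"
proof (rule ConI)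
  show "\<alpha> \<inter> \<beta> \<subseteq> univ B \<times> univ B" using Con_subset[OF assms(1)] by blast
  show "\<And>x. x \<in> univ B \<Longrightarrow> (x,x) \<in> \<alpha> \<inter> \<beta>" using Con_refl[OF assms(1)] Con_refl[OF assms(2)] by blast
  show "\<And>x y. (x,y) \<in> \<alpha> \<inter> \<beta> \<Longrightarrow> (y,x) \<in> \<alpha> \<inter> \<beta>" using Con_sym[OF assms(1)] Con_sym[OF assms(2)] by blast
  show "\<And>x y z. (x,y) \<in> \<alpha> \<inter> \<beta> \<Longrightarrow> (y,z) \<in> \<alpha> \<inter> \<beta> \<Longrightarrow> (x,z) \<in> \<alpha> \<inter> \<beta>"
    using Con_trans[OF assms(1)] Con_trans[OF assms(2)] by blast
qed (use assms in \<open>auto intro: Con_opr\<close>)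

lemma Cg_Con:
  assumes "algebra ar B"
  shows "Cg ar B R \<in> Con ar B"
proof (rule ConI)
  show "Cg ar B R \<subseteq> univ B \<times> univ B" by (auto simp: Cg_def Nabla_def)
  show "\<And>x. x \<in> univ B \<Longrightarrow> (x,x) \<in> Cg ar B R"
    by (auto simp: Cg_def Nabla_def dest: Con_refl)
  show "\<And>x y. (x,y) \<in> Cg ar B R \<Longrightarrow> (y,x) \<in> Cg ar B R"
    by (auto simp: Cg_def Nabla_def dest: Con_sym)
  show "\<And>x y z. (x,y) \<in> Cg ar B R \<Longrightarrow> (y,z) \<in> Cg ar B R \<Longrightarrow> (x,z) \<in> Cg ar B R"
    by (auto simp: Cg_def Nabla_def dest: Con_trans)
  show "(opr B f xs, opr B f ys) \<in> Cg ar B R"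
    if "length xs = ar f" "length ys = ar f" "\<And>i. i < ar f \<Longrightarrow> (xs ! i, ys ! i) \<in> Cg ar B R"
    for f xs ys
    using that Con_opr[OF Nabla_Con[OF assms], of xs f ys]
    by (auto simp: Cg_def intro: Con_opr)
qed

lemma Cg_upper: "R \<subseteq> Nabla B \<Longrightarrow> R \<subseteq> Cg ar B R"
  by (auto simp: Cg_def)

lemma Cg_least: "\<gamma> \<in> Con ar B \<Longrightarrow> R \<subseteq> \<gamma> \<Longrightarrow> Cg ar B R \<subseteq> \<gamma>"
  by (auto simp: Cg_def)

lemma Con_Nabla_subset: "\<alpha> \<in> Con ar B \<Longrightarrow> \<alpha> \<subseteq> Nabla B"
  by (simp add: Con_subset Nabla_def)

lemma cjoin_upper:
  assumes "\<alpha> \<in> Con ar B" "\<beta> \<in> Con ar B"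
  shows "\<alpha> \<subseteq> cjoin ar B \<alpha> \<beta>" "\<beta> \<subseteq> cjoin ar B \<alpha> \<beta>"
  using Cg_upper[of "\<alpha> \<union> \<beta>" B ar] Con_Nabla_subset[OF assms(1)] Con_Nabla_subset[OF assms(2)]
  by (auto simp: cjoin_def)

lemma cjoin_least: "\<gamma> \<in> Con ar B \<Longrightarrow> \<alpha> \<subseteq> \<gamma> \<Longrightarrow> \<beta> \<subseteq> \<gamma> \<Longrightarrow> cjoin ar B \<alpha> \<beta> \<subseteq> \<gamma>"
  unfolding cjoin_def by (rule Cg_least) auto

lemma cjoin_Con: "algebra ar B \<Longrightarrow> cjoin ar B \<alpha> \<beta> \<in> Con ar B"
  by (simp add: cjoin_def Cg_Con)

section \<open>Evaluation of terms and renaming of variables\<close>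

lemma eval_univ:
  assumes "algebra ar B" "range \<sigma> \<subseteq> univ B"
  shows "wf_trm ar t \<Longrightarrow> eval B \<sigma> t \<in> univ B"
proof (induction t)
  case (Var v)
  then show ?case using assms by auto
next
  case (App f ts)
  then show ?case by (auto intro!: algebra_opr[OF assms(1)])
qed

lemma eval_Con:
  assumes "\<psi> \<in> Con ar B" "\<And>v. (\<sigma> v, \<tau> v) \<in> \<psi>"
  shows "wf_trm ar t \<Longrightarrow> (eval B \<sigma> t, eval B \<tau> t) \<in> \<psi>"
proof (induction t)
  case (Var v)
  then show ?case using assms by auto
next
  case (App f ts)
  then show ?case by (auto intro!: Con_opr[OF assms(1)])
qed

lemma eval_map_trm: "eval B \<sigma> (map_trm id g t) = eval B (\<sigma> \<circ> g) t"
  by (induction t) (auto simp: comp_def intro!: arg_cong[where f = "opr B _"])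

lemma wf_map_trm: "wf_trm ar (map_trm id g t) = wf_trm ar t"
  by (induction t) auto

text \<open>Compatibility is checked one argument at a time: a chain of \<open>M\<close>-steps moves
  a single argument, and the arguments are then exchanged in turn, with transitivity joining the
  pieces.\<close>

lemma trancl_Con:
  assumes alg: "algebra ar B" and sub: "M \<subseteq> univ B \<times> univ B"
    and refl: "\<And>x. x \<in> univ B \<Longrightarrow> (x,x) \<in> M" and sym: "\<And>x y. (x,y) \<in> M \<Longrightarrow> (y,x) \<in> M"
    and repl: "\<And>f xs i y. length xs = ar f \<Longrightarrow> set xs \<subseteq> univ B \<Longrightarrow> i < ar f \<Longrightarrow>
      (xs ! i, y) \<in> M \<Longrightarrow> (opr B f xs, opr B f (xs[i := y])) \<in> M"
  shows "M\<^sup>+ \<in> Con ar B"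
proof (rule ConI)
  show sub': "M\<^sup>+ \<subseteq> univ B \<times> univ B" using sub by (rule trancl_subset_Sigma)
  show "\<And>x. x \<in> univ B \<Longrightarrow> (x,x) \<in> M\<^sup>+" using refl by blast
  have "sym M" using sym by (auto simp: sym_def)
  then show "\<And>x y. (x,y) \<in> M\<^sup>+ \<Longrightarrow> (y,x) \<in> M\<^sup>+" by (meson sym_trancl symD)
  show "\<And>x y z. (x,y) \<in> M\<^sup>+ \<Longrightarrow> (y,z) \<in> M\<^sup>+ \<Longrightarrow> (x,z) \<in> M\<^sup>+" by (rule trancl_trans)
  have repl': "(opr B f xs, opr B f (xs[i := y])) \<in> M\<^sup>+"
    if "length xs = ar f" "set xs \<subseteq> univ B" "i < ar f" "(xs ! i, y) \<in> M\<^sup>+" for f xs i y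
    using that(4)
  proof (induction rule: trancl_induct)
    case (base y)
    then show ?case using repl that by blast
  next
    case (step y z)
    have "set (xs[i := y]) \<subseteq> univ B"
      using step(2) sub that(2) set_update_subset_insert[of xs i y] by blast
    then have "(opr B f (xs[i := y]), opr B f (xs[i := y, i := z])) \<in> M"
      using step(2) that by (intro repl) auto
    then show ?case using step(3) by simp
  qed
  fix f xs ys
  assume l: "length xs = ar f" "length ys = ar f"
    and M: "\<And>i. i < ar f \<Longrightarrow> (xs ! i, ys ! i) \<in> M\<^sup>+"
  have xs: "xs ! i \<in> univ B" "ys ! i \<in> univ B" if "i < ar f" for i
    using M[OF that] sub' by auto
  \<comment> \<open>The interpolating list has its first \<open>n\<close> entries already exchanged.
    The case \<open>n = 0\<close> rests on reflexivity of \<open>M\<close>, since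
    \<open>M\<^sup>+\<close> has no empty chains.\<close>
  have "n \<le> ar f \<Longrightarrow> (opr B f xs, opr B f (take n ys @ drop n xs)) \<in> M\<^sup>+" for n
  proof (induction n)
    case 0
    have "opr B f xs \<in> univ B"
      by (rule algebra_opr[OF alg l(1)]) (use xs l in \<open>auto simp: in_set_conv_nth\<close>)
    then show ?case using refl by auto
  next
    case (Suc n)
    let ?zs = "take n ys @ drop n xs"
    have "set ?zs \<subseteq> univ B"
      using xs l by (auto dest!: in_set_takeD in_set_dropD simp: in_set_conv_nth)
    moreover have "?zs ! n = xs ! n" "length ?zs = ar f" using Suc.prems l by (auto simp: nth_append)
    moreover have "?zs[n := ys ! n] = take (Suc n) ys @ drop (Suc n) xs"
      using Suc.prems l
      by (simp add: list_update_append take_Suc_conv_app_nth upd_conv_take_nth_drop)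
    ultimately have "(opr B f ?zs, opr B f (take (Suc n) ys @ drop (Suc n) xs)) \<in> M\<^sup>+"
      using repl'[of ?zs f n "ys ! n"] M[of n] Suc.prems by simp
    then show ?case using Suc by (meson Suc_leD trancl_trans)
  qed
  from this[of "ar f"] show "(opr B f xs, opr B f ys) \<in> M\<^sup>+" using l by simp
qed

section \<open>Surjective homomorphisms\<close>

definition surj_hom :: "('f \<Rightarrow> nat) \<Rightarrow> ('b \<Rightarrow> 'c) \<Rightarrow> ('b,'f) alg \<Rightarrow> ('c,'f) alg \<Rightarrow> bool" where
  "surj_hom ar k B C \<longleftrightarrow> k ` univ B = univ C \<and>
     (\<forall>f xs. length xs = ar f \<and> set xs \<subseteq> univ B \<longrightarrow> opr C f (map k xs) = k (opr B f xs))"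

lemma surj_hom_opr:
  "surj_hom ar k B C \<Longrightarrow> length xs = ar f \<Longrightarrow> set xs \<subseteq> univ B \<Longrightarrow>
    opr C f (map k xs) = k (opr B f xs)"
  by (simp add: surj_hom_def)

lemma surj_hom_univ: "surj_hom ar k B C \<Longrightarrow> univ C = k ` univ B"
  by (simp add: surj_hom_def)

lemma surj_hom_lift:
  assumes "surj_hom ar k B C" "set ys \<subseteq> univ C"
  obtains xs where "length xs = length ys" "set xs \<subseteq> univ B" "ys = map k xs"
proof
  let ?xs = "map (inv_into (univ B) k) ys"
  have *: "set ys \<subseteq> k ` univ B" using assms by (simp add: surj_hom_def)
  show "length ?xs = length ys" by simp
  show "set ?xs \<subseteq> univ B" using * by (auto intro!: inv_into_into)
  show "ys = map k ?xs" using * by (auto simp: map_idI f_inv_into_f subset_iff intro!: nth_equalityI)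
qed

lemma surj_hom_algebra:
  assumes "surj_hom ar k B C" "algebra ar B"
  shows "algebra ar C"
  unfolding algebra_def
proof (intro conjI allI impI)
  show "univ C \<noteq> {}" using assms by (auto simp: surj_hom_def algebra_def)
  fix f ys assume ys: "length ys = ar f \<and> set ys \<subseteq> univ C"
  obtain xs where xs: "length xs = length ys" "set xs \<subseteq> univ B" "ys = map k xs"
    using surj_hom_lift[OF assms(1)] ys by blast
  then have "opr C f ys = k (opr B f xs)" using surj_hom_opr[OF assms(1)] ys by simp
  moreover have "opr B f xs \<in> univ B" using xs ys by (intro algebra_opr[OF assms(2)]) auto
  ultimately show "opr C f ys \<in> univ C" unfolding surj_hom_univ[OF assms(1)] by simp
qed

lemma surj_hom_eval:
  assumes "surj_hom ar k B C" "algebra ar B" "range \<sigma> \<subseteq> univ B"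
  shows "wf_trm ar t \<Longrightarrow> eval C (\<lambda>v. k (\<sigma> v)) t = k (eval B \<sigma> t)"
proof (induction t)
  case (Var v)
  then show ?case by simp
next
  case (App f ts)
  have "map (eval C (\<lambda>v. k (\<sigma> v))) ts = map k (map (eval B \<sigma>) ts)"
    using App by simp
  moreover have "opr C f (map k (map (eval B \<sigma>) ts)) = k (opr B f (map (eval B \<sigma>) ts))"
  proof -
    have "length (map (eval B \<sigma>) ts) = ar f" "set (map (eval B \<sigma>) ts) \<subseteq> univ B"
      using App.prems eval_univ[OF assms(2,3)] by auto
    then show ?thesis by (rule surj_hom_opr[OF assms(1)])
  qed
  ultimately show ?case by (simp only: eval.simps)
qed

text \<open>An assignment into \<open>C\<close> lifts to \<open>B\<close> by choosing preimages, and
  \<open>k\<close> commutes with evaluation. The latter is available for well-formed terms, hence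
  \<open>wf_ids\<close>.\<close>

lemma surj_hom_models:
  fixes C :: "('c,'f) alg"
  assumes "surj_hom ar k B C" "models ar \<Sigma> B" "wf_ids ar \<Sigma>"
  shows "models ar \<Sigma> C"
  unfolding models_def
proof (intro conjI ballI, safe)
  have alg: "algebra ar B" using assms by (simp add: models_def)
  then show "algebra ar C" using surj_hom_algebra assms by blast
  fix s t and \<sigma> :: "nat \<Rightarrow> 'c"
  assume st: "(s,t) \<in> \<Sigma>" and r: "range \<sigma> \<subseteq> univ C"
  define \<tau> where "\<tau> = inv_into (univ B) k \<circ> \<sigma>"
  have im: "range \<sigma> \<subseteq> k ` univ B" using r assms by (simp add: surj_hom_def)
  then have \<tau>: "range \<tau> \<subseteq> univ B" by (auto simp: \<tau>_def intro!: inv_into_into)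
  have \<sigma>: "\<sigma> = (\<lambda>v. k (\<tau> v))" using im by (auto simp: \<tau>_def f_inv_into_f range_subsetD)
  have "eval B \<tau> s = eval B \<tau> t" using assms(2) st \<tau> by (auto simp: models_def)
  moreover have "wf_trm ar s" "wf_trm ar t" using assms(3) st by (auto simp: wf_ids_def)
  ultimately show "eval C \<sigma> s = eval C \<sigma> t"
    unfolding \<sigma> using surj_hom_eval[OF assms(1) alg \<tau>] by simp
qed

lemma surj_hom_vimage_Con:
  assumes h: "surj_hom ar k B C" and alg: "algebra ar B" and \<gamma>: "\<gamma> \<in> Con ar C"
  shows "{(x,y). x \<in> univ B \<and> y \<in> univ B \<and> (k x, k y) \<in> \<gamma>} \<in> Con ar B" (is "?R \<in> _")
proof (rule ConI)
  have U: "\<And>x. x \<in> univ B \<Longrightarrow> k x \<in> univ C" using h by (auto simp: surj_hom_def)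
  show "?R \<subseteq> univ B \<times> univ B" by auto
  show "\<And>x. x \<in> univ B \<Longrightarrow> (x,x) \<in> ?R" using Con_refl[OF \<gamma>] U by auto
  show "\<And>x y. (x,y) \<in> ?R \<Longrightarrow> (y,x) \<in> ?R" using Con_sym[OF \<gamma>] by auto
  show "\<And>x y z. (x,y) \<in> ?R \<Longrightarrow> (y,z) \<in> ?R \<Longrightarrow> (x,z) \<in> ?R" using Con_trans[OF \<gamma>] by auto
  fix f xs ys
  assume l: "length xs = ar f" "length ys = ar f" and R: "\<And>i. i < ar f \<Longrightarrow> (xs ! i, ys ! i) \<in> ?R"
  have s: "set xs \<subseteq> univ B" "set ys \<subseteq> univ B" using R l by (auto simp: in_set_conv_nth)
  have "(opr C f (map k xs), opr C f (map k ys)) \<in> \<gamma>"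
    using l R by (intro Con_opr[OF \<gamma>]) auto
  then show "(opr B f xs, opr B f ys) \<in> ?R"
    using l s algebra_opr[OF alg] surj_hom_opr[OF h] by simp
qed

text \<open>Since \<gamma> contains the kernel of \<open>k\<close>, representatives may be exchanged
  freely inside \<gamma>. This is what makes the image of \<gamma> transitive and
  compatible.\<close>

lemma surj_hom_image_iff:
  assumes \<gamma>: "\<gamma> \<in> Con ar B" and ker: "\<And>x y. x \<in> univ B \<Longrightarrow> y \<in> univ B \<Longrightarrow> k x = k y \<Longrightarrow> (x,y) \<in> \<gamma>"
    and "x \<in> univ B" "y \<in> univ B"
  shows "(k x, k y) \<in> map_prod k k ` \<gamma> \<longleftrightarrow> (x,y) \<in> \<gamma>"
proof
  assume "(k x, k y) \<in> map_prod k k ` \<gamma>"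
  then obtain u v where uv: "k x = k u" "k y = k v" "(u,v) \<in> \<gamma>" by auto
  then have "u \<in> univ B" "v \<in> univ B" using Con_subset[OF \<gamma>] by auto
  then have "(x,u) \<in> \<gamma>" "(v,y) \<in> \<gamma>" using ker uv assms(3,4) by auto
  then show "(x,y) \<in> \<gamma>" using Con_trans[OF \<gamma>] uv(3) by blast
qed (force)

lemma surj_hom_image_Con:
  assumes h: "surj_hom ar k B C" and \<gamma>: "\<gamma> \<in> Con ar B"
    and ker: "\<And>x y. x \<in> univ B \<Longrightarrow> y \<in> univ B \<Longrightarrow> k x = k y \<Longrightarrow> (x,y) \<in> \<gamma>"
  shows "map_prod k k ` \<gamma> \<in> Con ar C" (is "?R \<in> _")
proof (rule ConI)
  have iff: "(k x, k y) \<in> ?R \<longleftrightarrow> (x,y) \<in> \<gamma>" if "x \<in> univ B" "y \<in> univ B" for x y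
    using ker that by (intro surj_hom_image_iff[OF \<gamma>])
  have U: "univ C = k ` univ B" using h by (auto simp: surj_hom_def)
  show sub: "?R \<subseteq> univ C \<times> univ C" using Con_subset[OF \<gamma>] U by auto
  show "\<And>x. x \<in> univ C \<Longrightarrow> (x,x) \<in> ?R" using Con_refl[OF \<gamma>] U by force
  show "(y,x) \<in> ?R" if "(x,y) \<in> ?R" for x y
  proof -
    obtain u v where "x = k u" "y = k v" "(u,v) \<in> \<gamma>"
      using \<open>(x,y) \<in> ?R\<close> by auto
    then show ?thesis using Con_sym[OF \<gamma>, of u v] by (auto intro: rev_image_eqI)
  qed
  show "(x,z) \<in> ?R" if R: "(x,y) \<in> ?R" "(y,z) \<in> ?R" for x y z
  proof -
    have "x \<in> k ` univ B" "y \<in> k ` univ B" "z \<in> k ` univ B"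
      using subsetD[OF sub R(1)] subsetD[OF sub R(2)] U by simp_all
    then obtain a b c where abc: "a \<in> univ B" "b \<in> univ B" "c \<in> univ B" "x = k a" "y = k b" "z = k c"
      by (metis imageE)
    have "(a,b) \<in> \<gamma>" "(b,c) \<in> \<gamma>"
      using R unfolding abc(4-6) iff[OF abc(1,2)] iff[OF abc(2,3)] .
    then have "(a,c) \<in> \<gamma>" by (rule Con_trans[OF \<gamma>])
    then show ?thesis unfolding abc(4-6) iff[OF abc(1,3)] .
  qed
  fix f xs ys
  assume l: "length xs = ar f" "length ys = ar f" and R: "\<And>i. i < ar f \<Longrightarrow> (xs ! i, ys ! i) \<in> ?R"
  have "set xs \<subseteq> univ C" "set ys \<subseteq> univ C" using R sub l by (fastforce simp: in_set_conv_nth)+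
  then obtain us vs where "length us = length xs" "length vs = length ys"
    and us: "set us \<subseteq> univ B" "xs = map k us" and vs: "set vs \<subseteq> univ B" "ys = map k vs"
    using surj_hom_lift[OF h] by metis
  then have l': "length us = ar f" "length vs = ar f" using l by auto
  have "(us ! i, vs ! i) \<in> \<gamma>" if "i < ar f" for i
  proof -
    have U': "us ! i \<in> univ B" "vs ! i \<in> univ B" using us(1) vs(1) l' that by (metis nth_mem subsetD)+
    have "(k (us ! i), k (vs ! i)) \<in> ?R" using R[OF that] that l' unfolding us(2) vs(2) by simp
    then show ?thesis unfolding iff[OF U'] .
  qed
  then have "(opr B f us, opr B f vs) \<in> \<gamma>" by (rule Con_opr[OF \<gamma> l'])
  then have "(k (opr B f us), k (opr B f vs)) \<in> ?R" by (auto intro: rev_image_eqI)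
  then show "(opr C f xs, opr C f ys) \<in> ?R"
    unfolding us(2) vs(2) surj_hom_opr[OF h l'(1) us(1)] surj_hom_opr[OF h l'(2) vs(1)] .
qed

section \<open>Image algebras and quotients\<close>

text \<open>A copy of \<open>B\<close> modulo the kernel of \<open>k\<close> on the target type of
  \<open>k\<close>. The preimages are arbitrary; the choice is immaterial once the kernel is a
  congruence.\<close>

definition img_alg :: "('b \<Rightarrow> 'c) \<Rightarrow> ('b,'f) alg \<Rightarrow> ('c,'f) alg" where
  "img_alg k B = (k ` univ B, \<lambda>f ys. k (opr B f (map (inv_into (univ B) k) ys)))"

lemma surj_hom_img_alg:
  assumes "\<psi> \<in> Con ar B" "\<And>x y. x \<in> univ B \<Longrightarrow> y \<in> univ B \<Longrightarrow> k x = k y \<longleftrightarrow> (x,y) \<in> \<psi>"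
  shows "surj_hom ar k B (img_alg k B)"
  unfolding surj_hom_def
proof (intro conjI allI impI)
  show "k ` univ B = univ (img_alg k B)" by (simp add: img_alg_def univ_def)
  fix f xs assume xs: "length xs = ar f \<and> set xs \<subseteq> univ B"
  let ?ys = "map (inv_into (univ B) k) (map k xs)"
  have e: "(?ys ! i, xs ! i) \<in> \<psi>" if "i < ar f" for i
  proof -
    have "k (xs ! i) \<in> k ` univ B" using xs that by (metis image_eqI nth_mem subsetD)
    then have "?ys ! i \<in> univ B" "k (?ys ! i) = k (xs ! i)"
      using xs that by (auto simp: inv_into_into f_inv_into_f)
    then show ?thesis using assms(2) xs that by (metis nth_mem subsetD)
  qed
  have *: "(opr B f ?ys, opr B f xs) \<in> \<psi>" using xs e by (intro Con_opr[OF assms(1)]) auto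
  then have "k (opr B f ?ys) = k (opr B f xs)"
    using assms(2) Con_subset[OF assms(1)] by blast
  then show "opr (img_alg k B) f (map k xs) = k (opr B f xs)" by (simp add: img_alg_def opr_def)
qed

lemma surj_hom_quot:
  assumes "\<theta> \<in> Con ar A"
  shows "surj_hom ar (\<lambda>x. \<theta> `` {x}) A (quot A \<theta>)"
  unfolding surj_hom_def
proof (intro conjI allI impI)
  show "(\<lambda>x. \<theta> `` {x}) ` univ A = univ (quot A \<theta>)"
    by (auto simp: quot_def univ_def quotient_def)
  fix f xs assume xs: "length xs = ar f \<and> set xs \<subseteq> univ A"
  let ?ys = "map (\<lambda>X. SOME x. x \<in> X) (map (\<lambda>x. \<theta> `` {x}) xs)"
  \<comment> \<open>\<open>quot\<close> computes with representatives picked by \<open>SOME\<close>.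
    They are \<theta>-related to the given ones, so the class of the result is the same.\<close>
  have e: "(?ys ! i, xs ! i) \<in> \<theta>" if "i < ar f" for i
  proof -
    have "xs ! i \<in> univ A" using xs that by (metis nth_mem subsetD)
    then have "xs ! i \<in> \<theta> `` {xs ! i}" using Con_refl[OF assms] by (simp add: Image_singleton_iff)
    then have "(SOME x. x \<in> \<theta> `` {xs ! i}) \<in> \<theta> `` {xs ! i}" by (rule someI)
    then have "(SOME x. x \<in> \<theta> `` {xs ! i}, xs ! i) \<in> \<theta>"
      unfolding Image_singleton_iff by (rule Con_sym[OF assms])
    moreover have "?ys ! i = (SOME x. x \<in> \<theta> `` {xs ! i})" using xs that by simp
    ultimately show ?thesis by (simp only:)
  qed
  have "length ?ys = ar f" "length xs = ar f" using xs by auto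
  then have "(opr A f ?ys, opr A f xs) \<in> \<theta>" using e by (rule Con_opr[OF assms])
  then have "\<theta> `` {opr A f ?ys} = \<theta> `` {opr A f xs}"
    by (rule equiv_class_eq[of "univ A", rotated]) (use assms in \<open>simp add: Con_def is_cong_def\<close>)
  then show "opr (quot A \<theta>) f (map (\<lambda>x. \<theta> `` {x}) xs) = \<theta> `` {opr A f xs}"
    by (simp add: quot_def opr_def)
qed

lemma class_eq_iff:
  assumes "\<theta> \<in> Con ar A" "x \<in> univ A" "y \<in> univ A"
  shows "\<theta> `` {x} = \<theta> `` {y} \<longleftrightarrow> (x,y) \<in> \<theta>"
  using assms by (intro eq_equiv_class_iff[of "univ A"]) (auto simp: Con_def is_cong_def)

lemma qcong_image: "qcong \<theta> \<alpha> = map_prod (\<lambda>x. \<theta> `` {x}) (\<lambda>x. \<theta> `` {x}) ` \<alpha>"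
  by (force simp: qcong_def)

lemma qcong_iff:
  assumes "\<theta> \<in> Con ar A" "\<gamma> \<in> Con ar A" "\<theta> \<subseteq> \<gamma>" "x \<in> univ A" "y \<in> univ A"
  shows "(\<theta> `` {x}, \<theta> `` {y}) \<in> qcong \<theta> \<gamma> \<longleftrightarrow> (x,y) \<in> \<gamma>"
  unfolding qcong_image
  by (rule surj_hom_image_iff[OF assms(2) _ assms(4,5)])
     (metis assms(1,3) class_eq_iff subsetD)

lemma qcong_Con:
  assumes "\<theta> \<in> Con ar A" "\<gamma> \<in> Con ar A" "\<theta> \<subseteq> \<gamma>"
  shows "qcong \<theta> \<gamma> \<in> Con ar (quot A \<theta>)"
  unfolding qcong_image
  by (rule surj_hom_image_Con[OF surj_hom_quot[OF assms(1)] assms(2)])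
     (metis assms(1,3) class_eq_iff subsetD)

section \<open>The Shifting Lemma and collapsing of idempotents\<close>

text \<open>The property in Gumm's Shifting Lemma: \<gamma> shifts from one \<beta>-side of a
  rectangle to the other. Congruence modularity enters the later arguments in this form
  only.\<close>

definition shifting :: "('f \<Rightarrow> nat) \<Rightarrow> ('b,'f) alg \<Rightarrow> bool" where
  "shifting ar B \<longleftrightarrow> (\<forall>\<alpha>\<in>Con ar B. \<forall>\<beta>\<in>Con ar B. \<forall>\<gamma>\<in>Con ar B. \<alpha> \<inter> \<beta> \<subseteq> \<gamma> \<longrightarrow>
     (\<forall>a b c d. (a,b) \<in> \<alpha> \<and> (c,d) \<in> \<alpha> \<and> (a,c) \<in> \<beta> \<and> (b,d) \<in> \<beta> \<and> (b,d) \<in> \<gamma> \<longrightarrow> (a,c) \<in> \<gamma>))"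

lemma shiftingD:
  assumes "shifting ar B" "\<alpha> \<in> Con ar B" "\<beta> \<in> Con ar B" "\<gamma> \<in> Con ar B" "\<alpha> \<inter> \<beta> \<subseteq> \<gamma>"
    "(a,b) \<in> \<alpha>" "(c,d) \<in> \<alpha>" "(a,c) \<in> \<beta>" "(b,d) \<in> \<beta>" "(b,d) \<in> \<gamma>"
  shows "(a,c) \<in> \<gamma>"
  using assms unfolding shifting_def by blast

text \<open>Semidegeneracy of the quotients, without forming them: the premise makes the class of
  \<open>e\<close> a one-element subalgebra modulo \<psi>, and the conclusion makes that quotient
  trivial.\<close>

definition collapsing :: "('f \<Rightarrow> nat) \<Rightarrow> ('b,'f) alg \<Rightarrow> bool" where
  "collapsing ar B \<longleftrightarrow> (\<forall>\<psi>\<in>Con ar B. \<forall>e\<in>univ B.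
     (\<forall>f. (opr B f (replicate (ar f) e), e) \<in> \<psi>) \<longrightarrow> \<psi> = Nabla B)"

lemma collapsingD:
  assumes "collapsing ar B" "\<psi> \<in> Con ar B" "e \<in> univ B"
    "\<And>f. (opr B f (replicate (ar f) e), e) \<in> \<psi>"
  shows "\<psi> = Nabla B"
  by (rule assms(1)[unfolded collapsing_def, rule_format, OF assms(2,3)]) (rule assms(4))

text \<open>Going round the rectangle over \<open>b\<close> and \<open>d\<close> puts
  \<open>(a,c)\<close> into the join of \<beta> \<inter> \<gamma> and \<alpha>, cut down to \<beta>.
  As \<beta> \<inter> \<gamma> lies below \<beta>, the modular law turns this into the join of
  \<beta> \<inter> \<gamma> and \<alpha> \<inter> \<beta>, both below \<gamma>.\<close>

lemma cong_modular_shifting: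
  assumes "algebra ar B" "cong_modular ar B"
  shows "shifting ar B"
  unfolding shifting_def
proof (intro ballI allI impI, elim conjE)
  fix \<alpha> \<beta> \<gamma> a b c d
  assume C: "\<alpha> \<in> Con ar B" "\<beta> \<in> Con ar B" "\<gamma> \<in> Con ar B" and sub: "\<alpha> \<inter> \<beta> \<subseteq> \<gamma>"
    and *: "(a,b) \<in> \<alpha>" "(c,d) \<in> \<alpha>" "(a,c) \<in> \<beta>" "(b,d) \<in> \<beta>" "(b,d) \<in> \<gamma>"
  let ?j = "cjoin ar B (\<beta> \<inter> \<gamma>) \<alpha>"
  have J: "?j \<in> Con ar B" using assms(1) by (rule cjoin_Con)
  have up: "\<beta> \<inter> \<gamma> \<subseteq> ?j" "\<alpha> \<subseteq> ?j"
    using cjoin_upper[OF Int_Con[OF C(2,3)] C(1)] by auto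
  have "(a,b) \<in> ?j" "(b,d) \<in> ?j" "(d,c) \<in> ?j" using up * Con_sym[OF C(1)] by auto
  then have "(a,c) \<in> ?j" using Con_trans[OF J] by blast
  moreover have "cjoin ar B (\<beta> \<inter> \<gamma>) (\<alpha> \<inter> \<beta>) = ?j \<inter> \<beta>"
    using assms(2) C Int_Con[OF C(2,3)] unfolding cong_modular_def by blast
  ultimately have "(a,c) \<in> cjoin ar B (\<beta> \<inter> \<gamma>) (\<alpha> \<inter> \<beta>)" using * by blast
  moreover have "cjoin ar B (\<beta> \<inter> \<gamma>) (\<alpha> \<inter> \<beta>) \<subseteq> \<gamma>" using sub by (intro cjoin_least C) auto
  ultimately show "(a,c) \<in> \<gamma>" by blast
qed

text \<open>Modularity is assumed for the type \<open>'c\<close>. The copy of \<open>B\<close> under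
  \<open>h\<close> belongs to the variety there, and injectivity lets the conclusion be read back in
  \<open>B\<close>.\<close>

lemma inj_shifting:
  fixes h :: "'b \<Rightarrow> 'c" and B :: "('b,'f) alg"
  assumes wf: "wf_ids ar \<Sigma>" and V: "\<And>C::('c,'f) alg. models ar \<Sigma> C \<Longrightarrow> cong_modular ar C"
    and h: "inj h" and B: "models ar \<Sigma> B"
  shows "shifting ar B"
  unfolding shifting_def
proof (intro ballI allI impI, elim conjE)
  fix \<alpha> \<beta> \<gamma> a b c d
  assume C: "\<alpha> \<in> Con ar B" "\<beta> \<in> Con ar B" "\<gamma> \<in> Con ar B" and sub: "\<alpha> \<inter> \<beta> \<subseteq> \<gamma>"
    and *: "(a,b) \<in> \<alpha>" "(c,d) \<in> \<alpha>" "(a,c) \<in> \<beta>" "(b,d) \<in> \<beta>" "(b,d) \<in> \<gamma>"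
  let ?C = "img_alg h B" and ?i = "\<lambda>\<delta>. map_prod h h ` \<delta>"
  have "Delta B \<in> Con ar B" using B by (simp add: models_def Delta_Con)
  then have hom: "surj_hom ar h B ?C"
    by (rule surj_hom_img_alg) (auto simp: Delta_def inj_eq[OF h])
  then have M: "models ar \<Sigma> ?C" using surj_hom_models B wf by blast
  have sh: "shifting ar ?C"
    using V[OF M] M by (auto simp: models_def intro: cong_modular_shifting)
  have I: "?i \<delta> \<in> Con ar ?C" if "\<delta> \<in> Con ar B" for \<delta>
    by (rule surj_hom_image_Con[OF hom that]) (use Con_refl[OF that] inj_eq[OF h] in auto)
  have iff: "(h x, h y) \<in> ?i \<delta> \<longleftrightarrow> (x,y) \<in> \<delta>" for x y \<delta>
    using inj_eq[OF h] by force
  have "?i \<alpha> \<inter> ?i \<beta> \<subseteq> ?i \<gamma>" using sub inj_eq[OF h] by force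
  then have "(h a, h c) \<in> ?i \<gamma>"
    using * by (intro shiftingD[OF sh I[OF C(1)] I[OF C(2)] I[OF C(3)], of "h a" "h b" "h c" "h d"])
      (auto simp: iff)
  then show "(a,c) \<in> \<gamma>" by (simp add: iff)
qed

text \<open>The quotient by \<psi> is realised inside \<open>'c\<close>, where semidegeneracy is
  assumed, as the image of a map with kernel \<psi>. The class of \<open>e\<close> becomes a
  one-element subalgebra there, so the quotient is trivial.\<close>

lemma inj_collapsing:
  fixes h :: "'b \<Rightarrow> 'c" and B :: "('b,'f) alg"
  assumes wf: "wf_ids ar \<Sigma>" and V: "\<And>C::('c,'f) alg. models ar \<Sigma> C \<Longrightarrow> semidegenerate_alg ar C"
    and h: "inj h" and B: "models ar \<Sigma> B"
  shows "collapsing ar B"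
  unfolding collapsing_def
proof (intro ballI impI)
  fix \<psi> e
  assume \<psi>: "\<psi> \<in> Con ar B" and e: "e \<in> univ B"
    and idem: "\<forall>f. (opr B f (replicate (ar f) e), e) \<in> \<psi>"
  \<comment> \<open>Related elements satisfy the same predicate under \<open>SOME\<close>, so
    \<open>k\<close> depends on the class only and codes it by a chosen member.\<close>
  define k where "k x = h (SOME y. (x,y) \<in> \<psi>)" for x
  have kiff: "k x = k y \<longleftrightarrow> (x,y) \<in> \<psi>" if "x \<in> univ B" "y \<in> univ B" for x y
  proof
    assume "(x,y) \<in> \<psi>"
    then have "(x,z) \<in> \<psi> \<longleftrightarrow> (y,z) \<in> \<psi>" for z using Con_sym[OF \<psi>] Con_trans[OF \<psi>] by blast
    then show "k x = k y" by (simp add: k_def)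
  next
    assume "k x = k y"
    then have "(SOME z. (x,z) \<in> \<psi>) = (SOME z. (y,z) \<in> \<psi>)" using h by (simp add: k_def inj_eq)
    moreover have "(w, SOME z. (w,z) \<in> \<psi>) \<in> \<psi>" if "w \<in> univ B" for w
      using Con_refl[OF \<psi> that] by (rule someI)
    ultimately show "(x,y) \<in> \<psi>" using \<open>x \<in> univ B\<close> \<open>y \<in> univ B\<close> Con_sym[OF \<psi>] Con_trans[OF \<psi>] by metis
  qed
  let ?C = "img_alg k B"
  have hom: "surj_hom ar k B ?C" by (rule surj_hom_img_alg[OF \<psi>]) (rule kiff)
  then have sd: "semidegenerate_alg ar ?C" using V surj_hom_models B wf by blast
  have U: "univ ?C = k ` univ B" using hom by (simp add: surj_hom_def)
  have "opr ?C f (replicate (ar f) (k e)) = k e" for f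
  proof -
    have "opr ?C f (map k (replicate (ar f) e)) = k (opr B f (replicate (ar f) e))"
      using e by (intro surj_hom_opr[OF hom]) auto
    also have "\<dots> = k e" using kiff idem e Con_subset[OF \<psi>] by blast
    finally show ?thesis by simp
  qed
  then have "k x = k y" if "x \<in> univ B" "y \<in> univ B" for x y
    using sd e that unfolding semidegenerate_alg_def U by blast
  then show "\<psi> = Nabla B" using kiff Con_subset[OF \<psi>] by (auto simp: Nabla_def)
qed

text \<open>Zorn's lemma. A finite set of pairs from the union of a chain lies in one member, so the
  union is a congruence; it stays proper because \<open>collapsing\<close> lets one pair per
  operation symbol generate \<open>Nabla B\<close>.\<close>

lemma ex_maximal_congruence:
  fixes ar :: "'f::finite \<Rightarrow> nat"
  assumes alg: "algebra ar B" and col: "collapsing ar B"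
    and \<chi>: "\<chi> \<in> Con ar B" "\<chi> \<noteq> Nabla B"
  obtains \<phi> where "max_cong ar B \<phi>" "\<chi> \<subseteq> \<phi>"
proof -
  let ?P = "{\<gamma> \<in> Con ar B. \<chi> \<subseteq> \<gamma> \<and> \<gamma> \<noteq> Nabla B}"
  obtain e where e: "e \<in> univ B" using alg by (auto simp: algebra_def)
  have "\<exists>M\<in>?P. \<forall>X\<in>?P. M \<subseteq> X \<longrightarrow> X = M"
  proof (rule subset_Zorn_nonempty)
    show "?P \<noteq> {}" using \<chi> by auto
    fix S assume S: "S \<noteq> {}" "subset.chain ?P S"
    have SC: "\<gamma> \<in> Con ar B" "\<chi> \<subseteq> \<gamma>" "\<gamma> \<noteq> Nabla B" if "\<gamma> \<in> S" for \<gamma>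
      using S that by (auto simp: subset.chain_def)
    have fin: "\<exists>\<gamma>\<in>S. F \<subseteq> \<gamma>" if "finite F" "F \<subseteq> \<Union>S" for F
      using finite_subset_Union_chain[OF that S(1)] S(2) by (metis)
    have C: "\<Union>S \<in> Con ar B"
    proof (rule ConI)
      show "\<Union>S \<subseteq> univ B \<times> univ B" using Con_subset[OF SC(1)] by blast
      show "\<And>x. x \<in> univ B \<Longrightarrow> (x,x) \<in> \<Union>S" using S(1) Con_refl[OF SC(1)] by blast
      show "(y,x) \<in> \<Union>S" if "(x,y) \<in> \<Union>S" for x y
        using that by (elim UnionE) (rule UnionI, assumption, rule Con_sym[OF SC(1)])
      show "(x,z) \<in> \<Union>S" if xyz: "(x,y) \<in> \<Union>S" "(y,z) \<in> \<Union>S" for x y z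
      proof -
        obtain \<gamma> where "\<gamma> \<in> S" "{(x,y),(y,z)} \<subseteq> \<gamma>" using fin[of "{(x,y),(y,z)}"] xyz by auto
        then show ?thesis using Con_trans[OF SC(1)[OF \<open>\<gamma> \<in> S\<close>], of x y z] by auto
      qed
      fix f xs ys
      assume l: "length xs = ar f" "length ys = ar f"
        and R: "\<And>i. i < ar f \<Longrightarrow> (xs ! i, ys ! i) \<in> \<Union>S"
      obtain \<gamma> where "\<gamma> \<in> S" "(\<lambda>i. (xs ! i, ys ! i)) ` {..<ar f} \<subseteq> \<gamma>"
        using fin[of "(\<lambda>i. (xs ! i, ys ! i)) ` {..<ar f}"] R by auto
      then have "(opr B f xs, opr B f ys) \<in> \<gamma>" by (intro Con_opr[OF SC(1)] l) auto
      then show "(opr B f xs, opr B f ys) \<in> \<Union>S" using \<open>\<gamma> \<in> S\<close> by blast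
    qed
    have "\<Union>S \<noteq> Nabla B"
    proof
      assume N: "\<Union>S = Nabla B"
      \<comment> \<open>Finiteness of the signature enters here.\<close>
      let ?F = "range (\<lambda>f. (opr B f (replicate (ar f) e), e))"
      have "?F \<subseteq> \<Union>S"
        unfolding N Nabla_def using e by (auto intro!: algebra_opr[OF alg])
      then obtain \<gamma> where "\<gamma> \<in> S" "?F \<subseteq> \<gamma>" using fin[of ?F] by auto
      then have "\<gamma> = Nabla B" by (intro collapsingD[OF col SC(1) e]) auto
      then show False using SC(3) \<open>\<gamma> \<in> S\<close> by blast
    qed
    then show "\<Union>S \<in> ?P" using C S(1) SC(2) by blast
  qed
  then obtain \<phi> where \<phi>: "\<phi> \<in> ?P" and max: "\<forall>X\<in>?P. \<phi> \<subseteq> X \<longrightarrow> X = \<phi>"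
    by (elim bexE)
  have "max_cong ar B \<phi>" unfolding max_cong_def
  proof (intro conjI ballI impI)
    fix \<psi> assume "\<psi> \<in> Con ar B" "\<phi> \<subseteq> \<psi>"
    then show "\<psi> = \<phi> \<or> \<psi> = Nabla B" using max[THEN bspec, of \<psi>] \<phi> by auto
  qed (use \<phi> in auto)
  moreover have "\<chi> \<subseteq> \<phi>" using \<phi> by auto
  ultimately show ?thesis by (rule that)
qed

section \<open>Centrality\<close>

text \<open>For a congruence \<beta>, this is \<beta> as a subalgebra of the square of
  \<open>A\<close>; its elements serve as the rows of matrices.\<close>

definition rel_alg :: "('a,'f) alg \<Rightarrow> ('a \<times> 'a) set \<Rightarrow> ('a \<times> 'a,'f) alg" where
  "rel_alg A \<beta> = (\<beta>, \<lambda>f us. (opr A f (map fst us), opr A f (map snd us)))"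

lemma univ_rel_alg [simp]: "univ (rel_alg A \<beta>) = \<beta>"
  and opr_rel_alg [simp]:
    "opr (rel_alg A \<beta>) f us = (opr A f (map fst us), opr A f (map snd us))"
  by (auto simp: rel_alg_def univ_def opr_def)

lemma eval_rel_alg:
  "eval (rel_alg A \<beta>) \<sigma> t = (eval A (\<lambda>v. fst (\<sigma> v)) t, eval A (\<lambda>v. snd (\<sigma> v)) t)"
proof (induction t)
  case (App f ts)
  then have "map fst (map (eval (rel_alg A \<beta>) \<sigma>) ts) = map (eval A (\<lambda>v. fst (\<sigma> v))) ts"
    "map snd (map (eval (rel_alg A \<beta>) \<sigma>) ts) = map (eval A (\<lambda>v. snd (\<sigma> v))) ts" by auto
  then show ?case by (simp only: eval.simps opr_rel_alg)
qed auto

lemma models_rel_alg: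
  fixes A :: "('a,'f) alg"
  assumes A: "models ar \<Sigma> A" and \<beta>: "\<beta> \<in> Con ar A"
  shows "models ar \<Sigma> (rel_alg A \<beta>)"
  unfolding models_def
proof (intro conjI ballI, safe)
  have "\<beta> \<noteq> {}" using A Con_refl[OF \<beta>] by (auto simp: models_def algebra_def)
  moreover have "opr (rel_alg A \<beta>) f us \<in> \<beta>" if "length us = ar f" "set us \<subseteq> \<beta>" for f us
  proof -
    have "us ! i \<in> \<beta>" if "i < ar f" for i using \<open>length us = ar f\<close> \<open>set us \<subseteq> \<beta>\<close> that by (metis nth_mem subsetD)
    then show ?thesis unfolding opr_rel_alg using that by (intro Con_opr[OF \<beta>]) simp_all
  qed
  ultimately show "algebra ar (rel_alg A \<beta>)" by (simp add: algebra_def)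
  fix s t and \<sigma> :: "nat \<Rightarrow> 'a \<times> 'a"
  assume st: "(s,t) \<in> \<Sigma>" and r: "range \<sigma> \<subseteq> univ (rel_alg A \<beta>)"
  have "range (\<lambda>v. fst (\<sigma> v)) \<subseteq> univ A" "range (\<lambda>v. snd (\<sigma> v)) \<subseteq> univ A"
    using r Con_subset[OF \<beta>] by (auto simp: subset_iff) (metis prod.collapse rangeI)+
  then show "eval (rel_alg A \<beta>) \<sigma> s = eval (rel_alg A \<beta>) \<sigma> t"
    using A st unfolding models_def eval_rel_alg by auto
qed

text \<open>The \<open>2 \<times> 2\<close> matrices \<open>M(\<alpha>,\<beta>)\<close> as pairs of rows: rows are \<open>\<beta>\<close>-related, columns \<open>\<alpha>\<close>-related. As in
  \<^const>\<open>centralizes\<close>, only one variable moves along \<open>\<alpha>\<close>; the transitive closure makes up for this.\<close>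

definition matrices ::
    "('f \<Rightarrow> nat) \<Rightarrow> ('a,'f) alg \<Rightarrow> ('a \<times> 'a) set \<Rightarrow> ('a \<times> 'a) set \<Rightarrow> (('a \<times> 'a) \<times> ('a \<times> 'a)) set" where
  "matrices ar A \<alpha> \<beta> =
     {((eval A (case_nat a c) t, eval A (case_nat a d) t),
       (eval A (case_nat b c) t, eval A (case_nat b d) t)) | (t :: ('f,nat) trm) a b c d.
      wf_trm ar t \<and> (a,b) \<in> \<alpha> \<and> (\<forall>i. (c i, d i) \<in> \<beta>)}"

lemma matricesI:
  "wf_trm ar t \<Longrightarrow> (a,b) \<in> \<alpha> \<Longrightarrow> (\<And>i. (c i, d i) \<in> \<beta>) \<Longrightarrow>
    p = eval A (case_nat a c) t \<Longrightarrow> q = eval A (case_nat a d) t \<Longrightarrow>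
    r = eval A (case_nat b c) t \<Longrightarrow> s = eval A (case_nat b d) t \<Longrightarrow>
    ((p,q),(r,s)) \<in> matrices ar A \<alpha> \<beta>"
  unfolding matrices_def by blast

lemma matricesE:
  assumes "(u,v) \<in> matrices ar A \<alpha> \<beta>"
  obtains t a b c d where "wf_trm ar t" "(a,b) \<in> \<alpha>" "\<And>i. (c i, d i) \<in> \<beta>"
    "u = (eval A (case_nat a c) t, eval A (case_nat a d) t)"
    "v = (eval A (case_nat b c) t, eval A (case_nat b d) t)"
  using assms unfolding matrices_def by blast

lemma centralizes_matrices:
  "centralizes ar A \<alpha> \<beta> \<delta> \<longleftrightarrow> (\<forall>(u,v)\<in>matrices ar A \<alpha> \<beta>. u \<in> \<delta> \<longrightarrow> v \<in> \<delta>)"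
  unfolding centralizes_def matrices_def by fast

text \<open>Plugging the term of the matrix into argument \<open>i\<close> of \<open>f\<close> gives
  a new term; the other entries of \<open>us\<close>, being pairs in \<beta>, become additional
  parameters.\<close>

lemma matrices_replace:
  assumes us: "length us = ar f" "set us \<subseteq> \<beta>" "i < ar f" and m: "(us ! i, v) \<in> matrices ar A \<alpha> \<beta>"
  shows "(opr (rel_alg A \<beta>) f us, opr (rel_alg A \<beta>) f (us[i := v])) \<in> matrices ar A \<alpha> \<beta>"
proof -
  obtain t a b c d where t: "wf_trm ar t" "(a,b) \<in> \<alpha>" "\<And>i. (c i, d i) \<in> \<beta>"
    and ui: "us ! i = (eval A (case_nat a c) t, eval A (case_nat a d) t)"
    and v: "v = (eval A (case_nat b c) t, eval A (case_nat b d) t)"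
    using m by (rule matricesE) blast
  define n where "n = ar f"
  \<comment> \<open>Variable 0 remains the moving one. The old parameters are shifted by
    \<open>n\<close>, making room for the entries of \<open>us\<close>: \<open>Var (Suc j)\<close>
    reads entry \<open>j\<close>.\<close>
  define g where "g = case_nat 0 (\<lambda>m. Suc (n + m))"
  define s where "s = App f (map (\<lambda>j. if j = i then map_trm id g t else Var (Suc j)) [0..<n])"
  define c' where "c' m = (if m < n then fst (us ! m) else c (m - n))" for m
  define d' where "d' m = (if m < n then snd (us ! m) else d (m - n))" for m
  have g: "case_nat x c' \<circ> g = case_nat x c" "case_nat x d' \<circ> g = case_nat x d" for x
    by (auto simp: g_def c'_def d'_def split: nat.split)
  have us': "us ! m \<in> \<beta>" if "m < n" for m using us that by (auto simp: n_def)
  \<comment> \<open>\<open>y\<close> is a dummy, since only one coordinate of the updated entry is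
    read.\<close>
  have ev: "eval A (case_nat x c') s = opr A f (map fst (us[i := (eval A (case_nat x c) t, y)]))"
    "eval A (case_nat x d') s = opr A f (map snd (us[i := (y, eval A (case_nat x d) t)]))" for x y
    unfolding s_def eval.simps map_map
    by (rule arg_cong[where f = "opr A f"], rule nth_equalityI,
        use us in \<open>auto simp: n_def c'_def d'_def eval_map_trm g nth_list_update\<close>)+
  have wf: "wf_trm ar s" using t by (auto simp: s_def n_def wf_map_trm)
  have cd: "(c' m, d' m) \<in> \<beta>" for m using us' t by (auto simp: c'_def d'_def)
  have u: "us[i := (eval A (case_nat a c) t, eval A (case_nat a d) t)] = us"
    using ui by (metis list_update_id)
  show ?thesis
    unfolding opr_rel_alg v
    by (rule matricesI[OF wf t(2) cd ev(1)[of a "eval A (case_nat a d) t", unfolded u, symmetric]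
          ev(2)[of a "eval A (case_nat a c) t", unfolded u, symmetric] ev(1)[symmetric] ev(2)[symmetric]])
qed

context
  fixes ar :: "'f \<Rightarrow> nat" and A :: "('a,'f) alg" and \<alpha> \<beta> :: "('a \<times> 'a) set"
  assumes alg: "algebra ar A" and \<alpha>: "\<alpha> \<in> Con ar A" and \<beta>: "\<beta> \<in> Con ar A"
begin

text \<open>A matrix is the image of \<open>((a,a),(b,b))\<close>, with
  \<open>(a,b) \<in> \<alpha>\<close>, under the unary polynomial of
  \<open>rel_alg A \<beta>\<close> given by the term and the parameters \<open>(c i, d i)\<close>.
  The closure is thus Maltsev's description of the congruence generated by these diagonal
  pairs.\<close>

lemma matrices_trancl_Con:
  assumes algR: "algebra ar (rel_alg A \<beta>)"
  shows "(matrices ar A \<alpha> \<beta>)\<^sup>+ \<in> Con ar (rel_alg A \<beta>)"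
proof (rule trancl_Con[OF algR])
  let ?M = "matrices ar A \<alpha> \<beta>"
  show "?M \<subseteq> univ (rel_alg A \<beta>) \<times> univ (rel_alg A \<beta>)"
  proof (clarsimp, elim matricesE, clarsimp)
    fix t :: "('f,nat) trm" and a b and c d :: "nat \<Rightarrow> 'a" assume t: "wf_trm ar t" "(a,b) \<in> \<alpha>" "\<And>i. (c i, d i) \<in> \<beta>"
    have "(a,a) \<in> \<beta>" "(b,b) \<in> \<beta>" using t(2) Con_subset[OF \<alpha>] Con_refl[OF \<beta>] by auto
    then show "(eval A (case_nat a c) t, eval A (case_nat a d) t) \<in> \<beta> \<and>
        (eval A (case_nat b c) t, eval A (case_nat b d) t) \<in> \<beta>"
      using t by (intro conjI eval_Con[OF \<beta>]) (auto split: nat.split)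
  qed
  show "(u,u) \<in> ?M" if "u \<in> univ (rel_alg A \<beta>)" for u
  proof -
    have *: "(fst u, snd u) \<in> \<beta>" using that by simp
    then have "(fst u, fst u) \<in> \<alpha>" using Con_subset[OF \<beta>] Con_refl[OF \<alpha>] by auto
    \<comment> \<open>\<open>Var 1\<close> ignores the moving variable and reads a parameter, so
      both rows are \<open>u\<close>.\<close>
    then have "((fst u, snd u),(fst u, snd u)) \<in> ?M"
      using * by (intro matricesI[of ar "Var 1" "fst u" "fst u" _ "\<lambda>_. fst u" "\<lambda>_. snd u"]) auto
    then show ?thesis by simp
  qed
  show "(v,u) \<in> ?M" if "(u,v) \<in> ?M" for u v
  proof -
    obtain t a b c d where t: "wf_trm ar t" "(a,b) \<in> \<alpha>" "\<And>i. (c i, d i) \<in> \<beta>"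
      and uv: "u = (eval A (case_nat a c) t, eval A (case_nat a d) t)"
        "v = (eval A (case_nat b c) t, eval A (case_nat b d) t)"
      using \<open>(u,v) \<in> ?M\<close> by (rule matricesE) blast
    show ?thesis unfolding uv by (rule matricesI[OF t(1) Con_sym[OF \<alpha> t(2)] t(3)]) auto
  qed
qed (rule matrices_replace; simp)

lemma diagonal_matrices:
  assumes "(a,b) \<in> \<alpha>"
  shows "((a,a),(b,b)) \<in> (matrices ar A \<alpha> \<beta>)\<^sup>+"
proof -
  have "(a,a) \<in> \<beta>" using assms Con_subset[OF \<alpha>] Con_refl[OF \<beta>] by auto
  then have "((a,a),(b,b)) \<in> matrices ar A \<alpha> \<beta>"
    using assms by (intro matricesI[of ar "Var 0" a b _ "\<lambda>_. a" "\<lambda>_. a"]) auto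
  then show ?thesis by blast
qed

section \<open>Monotonicity and symmetry of centrality\<close>

lemma centralizes_trancl:
  assumes "centralizes ar A \<alpha> \<beta> \<delta>" "(u,v) \<in> (matrices ar A \<alpha> \<beta>)\<^sup>+" "u \<in> \<delta>"
  shows "v \<in> \<delta>"
  using assms(2,3)
  by (induction rule: trancl_induct) (use assms(1) in \<open>auto simp: centralizes_matrices\<close>)

text \<open>Used with \<open>Delta A\<close>, where these are the kernels of the projections, and
  with the congruence modulo which centrality is tested.\<close>

lemma fst_snd_Con:
  assumes "\<delta> \<in> Con ar A"
  shows fst_Con: "{(u,v). u \<in> \<beta> \<and> v \<in> \<beta> \<and> (fst u, fst v) \<in> \<delta>} \<in> Con ar (rel_alg A \<beta>)"
    and snd_Con: "{(u,v). u \<in> \<beta> \<and> v \<in> \<beta> \<and> (snd u, snd v) \<in> \<delta>} \<in> Con ar (rel_alg A \<beta>)"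
proof -
  have "(opr A f (map fst us), opr A f (map snd us)) \<in> \<beta>"
    if "length us = ar f" "\<And>i. i < ar f \<Longrightarrow> us ! i \<in> \<beta>" for f us
    using that by (intro Con_opr[OF \<beta>]) auto
  note 1 = this
  have refl: "(x,x) \<in> \<delta>" "(y,y) \<in> \<delta>" if "(x,y) \<in> \<beta>" for x y
    using that Con_subset[OF \<beta>] Con_refl[OF assms] by auto
  show "{(u,v). u \<in> \<beta> \<and> v \<in> \<beta> \<and> (fst u, fst v) \<in> \<delta>} \<in> Con ar (rel_alg A \<beta>)"
    by (rule ConI) (auto simp: 1 intro: refl Con_sym[OF assms] Con_trans[OF assms]
        intro!: Con_opr[OF assms])
  show "{(u,v). u \<in> \<beta> \<and> v \<in> \<beta> \<and> (snd u, snd v) \<in> \<delta>} \<in> Con ar (rel_alg A \<beta>)"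
    by (rule ConI) (auto simp: 1 intro: refl Con_sym[OF assms] Con_trans[OF assms]
        intro!: Con_opr[OF assms])
qed

text \<open>The Shifting Lemma for the two projection kernels, which meet in the identity, replaces
  the common first entry \<open>x\<close> by \<open>y\<close>. The row \<open>(y,y)\<close> lies in
  \<delta>, so centrality puts \<open>(y,z)\<close> there.\<close>

lemma centralizes_shift:
  assumes algR: "algebra ar (rel_alg A \<beta>)" and sh: "shifting ar (rel_alg A \<beta>)"
    and cent: "centralizes ar A \<alpha> \<beta> \<delta>" and \<delta>: "\<delta> \<in> Con ar A"
    and xyz: "((x,y),(x,z)) \<in> (matrices ar A \<alpha> \<beta>)\<^sup>+"
  shows "(y,z) \<in> \<delta>"
proof -
  let ?\<psi> = "(matrices ar A \<alpha> \<beta>)\<^sup>+"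
  let ?\<eta>0 = "{(u,v). u \<in> \<beta> \<and> v \<in> \<beta> \<and> (fst u, fst v) \<in> Delta A}"
  let ?\<eta>1 = "{(u,v). u \<in> \<beta> \<and> v \<in> \<beta> \<and> (snd u, snd v) \<in> Delta A}"
  have \<psi>: "?\<psi> \<in> Con ar (rel_alg A \<beta>)" using algR by (rule matrices_trancl_Con)
  have \<beta>s: "(x,y) \<in> \<beta>" "(x,z) \<in> \<beta>" using Con_subset[OF \<psi>] xyz by auto
  then have U: "x \<in> univ A" "y \<in> univ A" "z \<in> univ A" using Con_subset[OF \<beta>] by auto
  have \<beta>s': "(y,y) \<in> \<beta>" "(y,z) \<in> \<beta>"
    using \<beta>s Con_sym[OF \<beta>] Con_trans[OF \<beta>] by blast+
  have D: "Delta A \<in> Con ar A" using alg by (rule Delta_Con)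
  have "((y,y),(y,z)) \<in> ?\<psi>"
  proof (rule shiftingD[OF sh snd_Con[OF D] fst_Con[OF D] \<psi>,
      where b = "(x,y)" and d = "(x,z)"])
    have "(u,u) \<in> ?\<psi>" if "u \<in> \<beta>" for u using Con_refl[OF \<psi>] that by simp
    then show "?\<eta>1 \<inter> ?\<eta>0 \<subseteq> ?\<psi>" by (auto simp: Delta_def)
  qed (use xyz \<beta>s \<beta>s' U in \<open>auto simp: Delta_def\<close>)
  then show ?thesis
    using centralizes_trancl[OF cent] Con_refl[OF \<delta>] U by blast
qed

text \<open>Complete the rows by the diagonal ones \<open>(p,p)\<close> and \<open>(r,r)\<close>. By
  \<open>centralizes_shift\<close>, related rows with equal first entries have \<delta>-related
  second entries, so the Shifting Lemma carries \<delta>' from \<open>(p,p)\<close>,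
  \<open>(p,q)\<close> to \<open>(r,r)\<close>, \<open>(r,s)\<close>.\<close>

lemma centralizes_mono:
  assumes algR: "algebra ar (rel_alg A \<beta>)" and sh: "shifting ar (rel_alg A \<beta>)"
    and cent: "centralizes ar A \<alpha> \<beta> \<delta>" and \<delta>: "\<delta> \<in> Con ar A"
    and \<delta>': "\<delta>' \<in> Con ar A" "\<delta> \<subseteq> \<delta>'"
  shows "centralizes ar A \<alpha> \<beta> \<delta>'"
  unfolding centralizes_matrices
proof (clarify)
  let ?\<psi> = "(matrices ar A \<alpha> \<beta>)\<^sup>+"
  let ?\<eta>0 = "{(u,v). u \<in> \<beta> \<and> v \<in> \<beta> \<and> (fst u, fst v) \<in> Delta A}"
  let ?\<gamma> = "{(u,v). u \<in> \<beta> \<and> v \<in> \<beta> \<and> (snd u, snd v) \<in> \<delta>'}"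
  fix p q r s
  assume M: "((p,q),(r,s)) \<in> matrices ar A \<alpha> \<beta>" and pq: "(p,q) \<in> \<delta>'"
  have \<psi>: "?\<psi> \<in> Con ar (rel_alg A \<beta>)" using algR by (rule matrices_trancl_Con)
  have D: "Delta A \<in> Con ar A" using alg by (rule Delta_Con)
  \<comment> \<open>The parameters stay fixed within a column, so columns lie in \<alpha>; this
    relates the diagonal rows.\<close>
  have "(p,r) \<in> \<alpha>"
  proof -
    obtain t a b c d where t: "wf_trm ar t" "(a,b) \<in> \<alpha>" "\<And>i. (c i, d i) \<in> \<beta>"
      and pr: "p = eval A (case_nat a c) t" "r = eval A (case_nat b c) t"
      using M by (rule matricesE) blast
    have "(c i, c i) \<in> \<alpha>" for i
      using subsetD[OF Con_subset[OF \<beta>] t(3)[of i]] Con_refl[OF \<alpha>] by simp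
    then show ?thesis unfolding pr using t by (intro eval_Con[OF \<alpha>]) (auto split: nat.split)
  qed
  then have diag: "((r,r),(p,p)) \<in> ?\<psi>" by (rule diagonal_matrices[OF Con_sym[OF \<alpha>]])
  have \<beta>s: "(p,q) \<in> \<beta>" "(r,s) \<in> \<beta>" using Con_subset[OF \<psi>] M by auto
  then have U: "p \<in> univ A" "q \<in> univ A" "r \<in> univ A" "s \<in> univ A" using Con_subset[OF \<beta>] by auto
  then have \<beta>s': "(p,p) \<in> \<beta>" "(r,r) \<in> \<beta>" using Con_refl[OF \<beta>] by auto
  have "((r,r),(r,s)) \<in> ?\<gamma>"
  proof (rule shiftingD[OF sh \<psi> fst_Con[OF D] snd_Con[OF \<delta>'(1)],
      where b = "(p,p)" and d = "(p,q)"])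
    show "?\<psi> \<inter> ?\<eta>0 \<subseteq> ?\<gamma>"
      using centralizes_shift[OF algR sh cent \<delta>] \<delta>'(2) by (auto simp: Delta_def)
    show "((r,s),(p,q)) \<in> ?\<psi>" using M Con_sym[OF \<psi>] by blast
  qed (use diag pq \<beta>s \<beta>s' U in \<open>auto simp: Delta_def\<close>)
  then show "(r,s) \<in> \<delta>'" by simp
qed

text \<open>Transposing a matrix exchanges \<alpha> and \<beta>. The rectangle is that of
  \<open>centralizes_mono\<close> with its directions exchanged: \<delta> now passes from the
  diagonal rows \<open>(p,p)\<close>, \<open>(r,r)\<close> to \<open>(p,q)\<close>,
  \<open>(r,s)\<close>.\<close>

lemma centralizes_sym:
  assumes algR: "algebra ar (rel_alg A \<beta>)" and sh: "shifting ar (rel_alg A \<beta>)"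
    and cent: "centralizes ar A \<alpha> \<beta> \<delta>" and \<delta>: "\<delta> \<in> Con ar A"
  shows "centralizes ar A \<beta> \<alpha> \<delta>"
  unfolding centralizes_def
proof (intro allI impI, elim conjE)
  let ?\<psi> = "(matrices ar A \<alpha> \<beta>)\<^sup>+"
  let ?\<eta>0 = "{(u,v). u \<in> \<beta> \<and> v \<in> \<beta> \<and> (fst u, fst v) \<in> Delta A}"
  let ?\<gamma> = "{(u,v). u \<in> \<beta> \<and> v \<in> \<beta> \<and> (snd u, snd v) \<in> \<delta>}"
  fix t :: "('f,nat) trm" and a b :: 'a and c d :: "nat \<Rightarrow> 'a"
  assume t: "wf_trm ar t" and ab: "(a,b) \<in> \<beta>" and cd: "\<forall>i. (c i, d i) \<in> \<alpha>"
  define p q r s where "p = eval A (case_nat a c) t" and "q = eval A (case_nat b c) t"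
    and "r = eval A (case_nat a d) t" and "s = eval A (case_nat b d) t"
  assume "(eval A (case_nat a c) t, eval A (case_nat a d) t) \<in> \<delta>"
  then have pr: "(p,r) \<in> \<delta>" by (simp add: p_def r_def)
  have \<psi>: "?\<psi> \<in> Con ar (rel_alg A \<beta>)" using algR by (rule matrices_trancl_Con)
  have D: "Delta A \<in> Con ar A" using alg by (rule Delta_Con)
  \<comment> \<open>Variable 0 is held at \<open>(a,b)\<close> while every parameter moves along a
    diagonal pair. Many variables move at once, hence the congruence \<open>?\<psi>\<close> instead
    of a single matrix.\<close>
  let ?\<sigma> = "case_nat (a,b) (\<lambda>i. (c i, c i))" and ?\<tau> = "case_nat (a,b) (\<lambda>i. (d i, d i))"
  have comps: "(\<lambda>v. fst (case_nat (x,y) (\<lambda>i. (f i, f i)) v)) = case_nat x f"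
    "(\<lambda>v. snd (case_nat (x,y) (\<lambda>i. (f i, f i)) v)) = case_nat y f" for x y :: 'a and f :: "nat \<Rightarrow> 'a"
    by (auto simp: fun_eq_iff split: nat.split)
  have "(eval (rel_alg A \<beta>) ?\<sigma> t, eval (rel_alg A \<beta>) ?\<tau> t) \<in> ?\<psi>"
    using t cd diagonal_matrices Con_refl[OF \<psi>] ab
    by (intro eval_Con[OF \<psi>]) (auto split: nat.split)
  then have M: "((p,q),(r,s)) \<in> ?\<psi>" by (simp add: eval_rel_alg comps p_def q_def r_def s_def)
  have "(p,r) \<in> \<alpha>"
    unfolding p_def r_def using t cd ab Con_refl[OF \<alpha>] Con_subset[OF \<beta>]
    by (intro eval_Con[OF \<alpha>]) (auto split: nat.split)
  then have diag: "((p,p),(r,r)) \<in> ?\<psi>" by (rule diagonal_matrices)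
  have \<beta>s: "(p,q) \<in> \<beta>" "(r,s) \<in> \<beta>" using Con_subset[OF \<psi>] M by auto
  then have U: "p \<in> univ A" "q \<in> univ A" "r \<in> univ A" "s \<in> univ A" using Con_subset[OF \<beta>] by auto
  then have \<beta>s': "(p,p) \<in> \<beta>" "(r,r) \<in> \<beta>" using Con_refl[OF \<beta>] by auto
  have "((p,q),(r,s)) \<in> ?\<gamma>"
  proof (rule shiftingD[OF sh fst_Con[OF D] \<psi> snd_Con[OF \<delta>],
      where b = "(p,p)" and d = "(r,r)"])
    show "?\<eta>0 \<inter> ?\<psi> \<subseteq> ?\<gamma>"
      using centralizes_shift[OF algR sh cent \<delta>] by (auto simp: Delta_def)
  qed (use M diag pr \<beta>s \<beta>s' U in \<open>auto simp: Delta_def\<close>)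
  then show "(eval A (case_nat b c) t, eval A (case_nat b d) t) \<in> \<delta>" by (simp add: q_def s_def)
qed

end

section \<open>Primeness of maximal congruences\<close>

text \<open>The columns lie in \<alpha>, so transitivity carries \<alpha> from the first row to the
  second.\<close>

lemma centralizes_self:
  fixes ar :: "'f \<Rightarrow> nat" and A :: "('a,'f) alg"
  assumes \<alpha>: "\<alpha> \<in> Con ar A" and \<beta>: "\<beta> \<in> Con ar A"
  shows "centralizes ar A \<alpha> \<beta> \<alpha>"
  unfolding centralizes_def
proof (intro allI impI, elim conjE)
  fix t :: "('f,nat) trm" and a b :: 'a and c d :: "nat \<Rightarrow> 'a"
  assume t: "wf_trm ar t" "(a,b) \<in> \<alpha>" "\<forall>i. (c i, d i) \<in> \<beta>"
    and e: "(eval A (case_nat a c) t, eval A (case_nat a d) t) \<in> \<alpha>"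
  have "(c i, c i) \<in> \<alpha>" "(d i, d i) \<in> \<alpha>" for i
    using t(3) Con_subset[OF \<beta>] Con_refl[OF \<alpha>] by auto
  then have "(eval A (case_nat b c) t, eval A (case_nat a c) t) \<in> \<alpha>"
    "(eval A (case_nat a d) t, eval A (case_nat b d) t) \<in> \<alpha>"
    using t Con_sym[OF \<alpha> t(2)] by (auto intro!: eval_Con[OF \<alpha>] split: nat.split)
  then show "(eval A (case_nat b c) t, eval A (case_nat b d) t) \<in> \<alpha>"
    using e Con_trans[OF \<alpha>] by blast
qed

text \<open>For fixed \<beta> and \<phi>, the pairs along which the centrality implication holds
  compose. They include those of \<alpha> and, by \<open>centralizes_self\<close>, of \<phi>;
  together these generate \<open>Nabla A\<close> by maximality.\<close>

lemma centralizes_Nabla_left: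
  fixes ar :: "'f \<Rightarrow> nat" and A :: "('a,'f) alg"
  assumes alg: "algebra ar A" and C: "\<alpha> \<in> Con ar A" "\<beta> \<in> Con ar A" and \<phi>: "max_cong ar A \<phi>"
    and cent: "centralizes ar A \<alpha> \<beta> \<phi>" and nsub: "\<not> \<alpha> \<subseteq> \<phi>"
  shows "centralizes ar A (Nabla A) \<beta> \<phi>"
proof -
  have \<phi>C: "\<phi> \<in> Con ar A" using \<phi> by (simp add: max_cong_def)
  let ?T = "(\<alpha> \<union> \<phi>)\<^sup>+"
  have repl: "(opr A f xs, opr A f (xs[i := y])) \<in> \<gamma>"
    if "length xs = ar f" "set xs \<subseteq> univ A" "i < ar f" "(xs ! i, y) \<in> \<gamma>" "\<gamma> \<in> Con ar A"
    for f xs i y \<gamma>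
    using that Con_refl[OF that(5)]
    by (intro Con_opr[OF that(5)]) (auto simp: nth_list_update subset_iff)
  have "?T \<in> Con ar A"
  proof (rule trancl_Con[OF alg])
    show "\<alpha> \<union> \<phi> \<subseteq> univ A \<times> univ A" using Con_subset[OF C(1)] Con_subset[OF \<phi>C] by auto
    show "\<And>x. x \<in> univ A \<Longrightarrow> (x,x) \<in> \<alpha> \<union> \<phi>" using Con_refl[OF \<phi>C] by auto
    show "\<And>x y. (x,y) \<in> \<alpha> \<union> \<phi> \<Longrightarrow> (y,x) \<in> \<alpha> \<union> \<phi>" using Con_sym[OF C(1)] Con_sym[OF \<phi>C] by auto
  qed (use repl[OF _ _ _ _ C(1)] repl[OF _ _ _ _ \<phi>C] in blast)
  moreover have "\<alpha> \<union> \<phi> \<subseteq> ?T" by auto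
  ultimately have T: "?T = Nabla A" using \<phi> nsub unfolding max_cong_def by blast
  have cent': "centralizes ar A \<phi> \<beta> \<phi>"
    by (rule centralizes_self[OF \<phi>C C(2)])
  show ?thesis
    unfolding centralizes_def T[symmetric]
  proof (intro allI impI, elim conjE)
    fix t :: "('f,nat) trm" and a b :: 'a and c d :: "nat \<Rightarrow> 'a"
    assume t: "wf_trm ar t" and cd: "\<forall>i. (c i, d i) \<in> \<beta>"
      and e: "(eval A (case_nat a c) t, eval A (case_nat a d) t) \<in> \<phi>"
    assume "(a,b) \<in> ?T"
    then show "(eval A (case_nat b c) t, eval A (case_nat b d) t) \<in> \<phi>"
    proof (induction rule: trancl_induct)
      case (base b)
      then show ?case using cent cent' t cd e unfolding centralizes_def by blast
    next
      case (step b b')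
      then show ?case using cent cent' t cd unfolding centralizes_def by blast
    qed
  qed
qed

text \<open>The diagonal is an idempotent class of the congruence generated by the matrices.\<close>

lemma not_abelian_quotient:
  assumes alg: "algebra ar A" and col: "collapsing ar (rel_alg A (Nabla A))"
    and algR: "algebra ar (rel_alg A (Nabla A))"
    and \<phi>: "\<phi> \<in> Con ar A" and cent: "centralizes ar A (Nabla A) (Nabla A) \<phi>"
  shows "\<phi> = Nabla A"
proof -
  let ?N = "Nabla A" and ?R = "rel_alg A (Nabla A)"
  let ?\<psi> = "(matrices ar A ?N ?N)\<^sup>+"
  have N: "?N \<in> Con ar A" using alg by (rule Nabla_Con)
  have \<psi>: "?\<psi> \<in> Con ar ?R" by (rule matrices_trancl_Con[OF alg N N algR])
  obtain e where e: "e \<in> univ A" using alg by (auto simp: algebra_def)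
  then have ee: "(e,e) \<in> univ ?R" by (simp add: Nabla_def)
  have "opr A f (replicate (ar f) e) \<in> univ A" for f
    using e by (auto intro!: algebra_opr[OF alg])
  then have "(opr ?R f (replicate (ar f) (e,e)), (e,e)) \<in> ?\<psi>" for f
    using e by (auto simp: Nabla_def intro!: diagonal_matrices[OF alg N N, unfolded Nabla_def])
  then have eq: "?\<psi> = Nabla ?R" 
    by (rule collapsingD[OF col \<psi> ee])
  have "(x,y) \<in> \<phi>" if "x \<in> univ A" "y \<in> univ A" for x y
  proof -
    \<comment> \<open>The row \<open>(x,x)\<close> lies in \<phi>, and centrality carries this over
      to \<open>(x,y)\<close>.\<close>
    have "((x,x),(x,y)) \<in> ?\<psi>" using that unfolding eq by (auto simp: Nabla_def)
    then show ?thesis using centralizes_trancl[OF alg N N cent] Con_refl[OF \<phi>] that by blast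
  qed
  then show ?thesis using Con_subset[OF \<phi>] by (auto simp: Nabla_def)
qed

text \<open>Monotonicity raises \<theta> to \<phi>. If neither side lay below \<phi>, the left one
  could be enlarged to \<open>Nabla A\<close>, the sides swapped by symmetry, and the other enlarged
  too, making the quotient by \<phi> abelian.\<close>

lemma max_cong_prime:
  assumes alg: "algebra ar A"
    and algR: "\<forall>\<beta>\<in>Con ar A. algebra ar (rel_alg A \<beta>)"
    and sh: "\<forall>\<beta>\<in>Con ar A. shifting ar (rel_alg A \<beta>)"
    and col: "collapsing ar (rel_alg A (Nabla A))"
    and \<phi>: "max_cong ar A \<phi>" and \<theta>: "\<theta> \<in> Con ar A" "\<theta> \<subseteq> \<phi>"
    and C: "\<alpha> \<in> Con ar A" "\<beta> \<in> Con ar A" and cent: "centralizes ar A \<alpha> \<beta> \<theta>"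
  shows "\<alpha> \<subseteq> \<phi> \<or> \<beta> \<subseteq> \<phi>"
proof (rule ccontr)
  assume neg: "\<not> (\<alpha> \<subseteq> \<phi> \<or> \<beta> \<subseteq> \<phi>)"
  have \<phi>C: "\<phi> \<in> Con ar A" using \<phi> by (simp add: max_cong_def)
  have N: "Nabla A \<in> Con ar A" using alg by (rule Nabla_Con)
  have "centralizes ar A \<alpha> \<beta> \<phi>"
    by (rule centralizes_mono[OF alg C algR[rule_format, OF C(2)] sh[rule_format, OF C(2)] cent \<theta>(1) \<phi>C \<theta>(2)])
  then have "centralizes ar A (Nabla A) \<beta> \<phi>"
    using centralizes_Nabla_left[OF alg C \<phi>] neg by blast
  then have "centralizes ar A \<beta> (Nabla A) \<phi>"
    using centralizes_sym[OF alg N C(2) algR[rule_format, OF C(2)] sh[rule_format, OF C(2)]] \<phi>C by blast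
  then have "centralizes ar A (Nabla A) (Nabla A) \<phi>"
    using centralizes_Nabla_left[OF alg C(2) N \<phi>] neg by blast
  then have "\<phi> = Nabla A" using not_abelian_quotient[OF alg col algR[rule_format, OF N] \<phi>C] by blast
  then show False using \<phi> by (simp add: max_cong_def)
qed

section \<open>Commutators and passage to the quotient\<close>

text \<open>The centrality implication survives intersections, and \<open>Nabla A\<close> contains
  all values of well-formed terms on the carrier.\<close>

lemma centralizes_comm:
  fixes ar :: "'f \<Rightarrow> nat" and A :: "('a,'f) alg"
  assumes alg: "algebra ar A" and C: "\<alpha> \<in> Con ar A" "\<beta> \<in> Con ar A"
  shows "centralizes ar A \<alpha> \<beta> (comm ar A \<alpha> \<beta>)"
  unfolding centralizes_def
proof (intro allI impI, elim conjE)
  fix t :: "('f,nat) trm" and a b :: 'a and c d :: "nat \<Rightarrow> 'a"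
  assume t: "wf_trm ar t" "(a,b) \<in> \<alpha>" "\<forall>i. (c i, d i) \<in> \<beta>"
    and e: "(eval A (case_nat a c) t, eval A (case_nat a d) t) \<in> comm ar A \<alpha> \<beta>"
  have "b \<in> univ A" "c i \<in> univ A" "d i \<in> univ A" for i
    using t Con_subset[OF C(1)] Con_subset[OF C(2)] by auto
  then have "(eval A (case_nat b c) t, eval A (case_nat b d) t) \<in> Nabla A"
    unfolding Nabla_def using t(1)
    by (auto intro!: eval_univ[OF alg] split: nat.splits)
  moreover have "(eval A (case_nat b c) t, eval A (case_nat b d) t) \<in> \<delta>"
    if "\<delta> \<in> Con ar A" "centralizes ar A \<alpha> \<beta> \<delta>" for \<delta>
  proof -
    have "(eval A (case_nat a c) t, eval A (case_nat a d) t) \<in> \<delta>"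
      using e that by (auto simp: comm_def)
    then show ?thesis using that(2) t unfolding centralizes_def by blast
  qed
  ultimately show "(eval A (case_nat b c) t, eval A (case_nat b d) t) \<in> comm ar A \<alpha> \<beta>"
    by (auto simp: comm_def)
qed

text \<open>The meet itself takes part in the intersection defining \<open>comm\<close>: all rows
  lie in \<beta>, and \<alpha> passes from row to row by \<open>centralizes_self\<close>.\<close>

lemma comm_disjoint:
  fixes ar :: "'f \<Rightarrow> nat" and A :: "('a,'f) alg"
  assumes alg: "algebra ar A" and C: "\<alpha> \<in> Con ar A" "\<beta> \<in> Con ar A" and D: "\<alpha> \<inter> \<beta> = Delta A"
  shows "comm ar A \<alpha> \<beta> = Delta A"
proof
  have "centralizes ar A \<alpha> \<beta> (\<alpha> \<inter> \<beta>)"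
    unfolding centralizes_def
  proof (intro allI impI, elim conjE)
    fix t :: "('f,nat) trm" and a b :: 'a and c d :: "nat \<Rightarrow> 'a"
    assume t: "wf_trm ar t" "(a,b) \<in> \<alpha>" "\<forall>i. (c i, d i) \<in> \<beta>"
      and e: "(eval A (case_nat a c) t, eval A (case_nat a d) t) \<in> \<alpha> \<inter> \<beta>"
    have "(b,b) \<in> \<beta>" using t(2) Con_subset[OF C(1)] Con_refl[OF C(2)] by auto
    then have "(eval A (case_nat b c) t, eval A (case_nat b d) t) \<in> \<beta>"
      using t by (intro eval_Con[OF C(2)]) (auto split: nat.split)
    moreover have "(eval A (case_nat b c) t, eval A (case_nat b d) t) \<in> \<alpha>"
      using centralizes_self[OF C] t e
      unfolding centralizes_def by blast
    ultimately show "(eval A (case_nat b c) t, eval A (case_nat b d) t) \<in> \<alpha> \<inter> \<beta>" by simp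
  qed
  then show "comm ar A \<alpha> \<beta> \<subseteq> Delta A" using Int_Con[OF C] D by (auto simp: comm_def)
  show "Delta A \<subseteq> comm ar A \<alpha> \<beta>"
    by (auto simp: comm_def Delta_def Nabla_def dest: Con_refl)
qed

text \<open>The class map commutes with evaluation, so matrices over \<open>A\<close> go to matrices
  over the quotient, and equality of classes there means \<theta>-relatedness in
  \<open>A\<close>.\<close>

lemma centralizes_pullback:
  fixes ar :: "'f \<Rightarrow> nat" and A :: "('a,'f) alg"
  assumes alg: "algebra ar A" and \<theta>: "\<theta> \<in> Con ar A" and C: "\<alpha> \<in> Con ar A" "\<beta> \<in> Con ar A"
    and cent: "centralizes ar (quot A \<theta>) (qcong \<theta> \<alpha>) (qcong \<theta> \<beta>) (Delta (quot A \<theta>))"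
  shows "centralizes ar A \<alpha> \<beta> \<theta>"
  unfolding centralizes_def
proof (intro allI impI, elim conjE)
  fix t :: "('f,nat) trm" and a b :: 'a and c d :: "nat \<Rightarrow> 'a"
  assume t: "wf_trm ar t" "(a,b) \<in> \<alpha>" "\<forall>i. (c i, d i) \<in> \<beta>"
    and e: "(eval A (case_nat a c) t, eval A (case_nat a d) t) \<in> \<theta>"
  let ?k = "\<lambda>x. \<theta> `` {x}" and ?Q = "quot A \<theta>"
  have hom: "surj_hom ar ?k A ?Q" using \<theta> by (rule surj_hom_quot)
  have U: "a \<in> univ A" "b \<in> univ A" "c i \<in> univ A" "d i \<in> univ A" for i
    using t Con_subset[OF C(1)] Con_subset[OF C(2)] by auto
  have rng: "range (case_nat x f) \<subseteq> univ A" if "x \<in> univ A" "\<And>i. f i \<in> univ A" for x f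
    using that by (auto split: nat.splits)
  have case_k: "(\<lambda>v. ?k (case_nat x f v)) = case_nat (?k x) (\<lambda>i. ?k (f i))" for x f
    by (rule ext) (simp split: nat.split)
  have ev: "eval ?Q (case_nat (?k x) (\<lambda>i. ?k (f i))) t = ?k (eval A (case_nat x f) t)"
    "eval A (case_nat x f) t \<in> univ A"
    if "x \<in> univ A" "\<And>i. f i \<in> univ A" for x f
    using surj_hom_eval[OF hom alg rng[of x f] t(1)] eval_univ[OF alg rng[of x f] t(1)] that
    by (auto simp: case_k)
  have D: "(?k x, ?k y) \<in> Delta ?Q \<longleftrightarrow> (x,y) \<in> \<theta>" if "x \<in> univ A" "y \<in> univ A" for x y
  proof -
    have "?k x \<in> univ ?Q" using hom that by (auto simp: surj_hom_def)
    then show ?thesis using class_eq_iff[OF \<theta> that] by (auto simp: Delta_def)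
  qed
  have "(?k a, ?k b) \<in> qcong \<theta> \<alpha>" "\<forall>i. (?k (c i), ?k (d i)) \<in> qcong \<theta> \<beta>"
    using t by (auto simp: qcong_def)
  then have "(eval ?Q (case_nat (?k a) (\<lambda>i. ?k (c i))) t, eval ?Q (case_nat (?k a) (\<lambda>i. ?k (d i))) t)
      \<in> Delta ?Q \<longrightarrow>
    (eval ?Q (case_nat (?k b) (\<lambda>i. ?k (c i))) t, eval ?Q (case_nat (?k b) (\<lambda>i. ?k (d i))) t)
      \<in> Delta ?Q"
    using cent[unfolded centralizes_def, THEN spec, of t, THEN spec, of "?k a", THEN spec, of "?k b",
        THEN spec, of "\<lambda>i. ?k (c i)", THEN spec, of "\<lambda>i. ?k (d i)"] t(1) by simp
  then show "(eval A (case_nat b c) t, eval A (case_nat b d) t) \<in> \<theta>"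
    using e U by (simp add: ev D)
qed

section \<open>Lifting B-normality\<close>

text \<open>The variety is only controlled on the carrier types \<^typ>\<open>nat\<close>, \<open>'a\<close> and \<open>'a set\<close>, so algebras
  on \<open>'a \<times> 'a\<close> are transported to one of the first two.\<close>

lemma square_embedding:
  "(\<exists>h :: 'a \<times> 'a \<Rightarrow> 'a. inj h) \<or> (\<exists>h :: 'a \<times> 'a \<Rightarrow> nat. inj h)"
proof (cases "finite (UNIV :: 'a set)")
  case True
  then have "finite (UNIV :: ('a \<times> 'a) set)" by (simp add: finite_Prod_UNIV)
  then show ?thesis using finite_imp_inj_to_nat_seg by blast
next
  case False
  include cardinal_syntax
  from False have "|(UNIV :: 'a set) \<times> (UNIV :: 'a set)| \<le>o |UNIV :: 'a set|"
    using card_of_Times_same_infinite ordIso_iff_ordLeq by blast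
  then show ?thesis unfolding card_of_ordLeq[symmetric] by auto
qed

text \<open>By correspondence \<gamma>/\<theta> lies above both joinands, hence is full. The form
  with an upper bound \<gamma> applies directly to a maximal congruence.\<close>

lemma quot_join_Nabla:
  assumes \<theta>: "\<theta> \<in> Con ar A"
    and join: "cjoin ar (quot A \<theta>) (qcong \<theta> (cjoin ar A \<chi> \<theta>)) (qcong \<theta> (cjoin ar A \<alpha> \<theta>)) =
      Nabla (quot A \<theta>)"
    and \<gamma>: "\<gamma> \<in> Con ar A" "\<chi> \<subseteq> \<gamma>" "\<theta> \<subseteq> \<gamma>" "\<alpha> \<subseteq> \<gamma>"
  shows "\<gamma> = Nabla A"
proof -
  let ?Q = "quot A \<theta>"
  have mono: "qcong \<theta> \<delta> \<subseteq> qcong \<theta> \<gamma>" if "\<delta> \<subseteq> \<gamma>" for \<delta> using that by (auto simp: qcong_def)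
  have "cjoin ar ?Q (qcong \<theta> (cjoin ar A \<chi> \<theta>)) (qcong \<theta> (cjoin ar A \<alpha> \<theta>)) \<subseteq> qcong \<theta> \<gamma>"
    by (intro cjoin_least qcong_Con \<theta> \<gamma> mono)
  then have "Nabla ?Q \<subseteq> qcong \<theta> \<gamma>" using join by simp
  moreover have "(\<theta> `` {x}, \<theta> `` {y}) \<in> Nabla ?Q" if "x \<in> univ A" "y \<in> univ A" for x y
    using surj_hom_quot[OF \<theta>] that by (auto simp: surj_hom_def Nabla_def)
  ultimately have "(x,y) \<in> \<gamma>" if "x \<in> univ A" "y \<in> univ A" for x y
    using that qcong_iff[OF \<theta> \<gamma>(1,3)] by blast
  then show ?thesis using Con_subset[OF \<gamma>(1)] by (auto simp: Nabla_def)
qed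

text \<open>The inverse image of the join under the class map is a congruence above \<chi> and
  \<epsilon>, hence full; the class map is onto.\<close>

lemma cjoin_qcong_Nabla:
  assumes alg: "algebra ar A" and C: "\<theta> \<in> Con ar A" "\<chi> \<in> Con ar A" "\<epsilon> \<in> Con ar A"
    and join: "cjoin ar A \<chi> \<epsilon> = Nabla A"
  shows "cjoin ar (quot A \<theta>) (qcong \<theta> (cjoin ar A \<chi> \<theta>)) (qcong \<theta> (cjoin ar A \<epsilon> \<theta>)) =
    Nabla (quot A \<theta>)" (is "?J = Nabla ?Q")
proof
  let ?k = "\<lambda>x. \<theta> `` {x}"
  have hom: "surj_hom ar ?k A ?Q" using C(1) by (rule surj_hom_quot)
  have algQ: "algebra ar ?Q" by (rule surj_hom_algebra[OF hom alg])
  then have J: "?J \<in> Con ar ?Q" by (rule cjoin_Con)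
  then show "?J \<subseteq> Nabla ?Q" by (rule Con_Nabla_subset)
  let ?P = "{(x,y). x \<in> univ A \<and> y \<in> univ A \<and> (?k x, ?k y) \<in> ?J}"
  have P: "?P \<in> Con ar A" by (rule surj_hom_vimage_Con[OF hom alg J])
  have Q: "qcong \<theta> (cjoin ar A \<delta> \<theta>) \<in> Con ar ?Q" if "\<delta> \<in> Con ar A" for \<delta>
    using that C(1) by (intro qcong_Con cjoin_Con alg cjoin_upper)
  have im: "(?k x, ?k y) \<in> qcong \<theta> (cjoin ar A \<delta> \<theta>)" if "\<delta> \<in> Con ar A" "(x,y) \<in> \<delta>" for \<delta> x y
    using cjoin_upper(1)[OF that(1) C(1)] that(2) by (auto simp: qcong_def)
  have "\<chi> \<subseteq> ?P" "\<epsilon> \<subseteq> ?P"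
    using im[OF C(2)] im[OF C(3)] cjoin_upper[OF Q[OF C(2)] Q[OF C(3)]]
      Con_subset[OF C(2)] Con_subset[OF C(3)] by blast+
  then have "Nabla A \<subseteq> ?P" using cjoin_least[OF P] join by blast
  then show "Nabla ?Q \<subseteq> ?J"
    unfolding Nabla_def surj_hom_univ[OF hom] by auto
qed

theorem theorem6p10:
  fixes ar :: "'f::finite \<Rightarrow> nat"
    and \<Sigma> :: "(('f,nat) trm \<times> ('f,nat) trm) set"
    and A :: "('a,'f) alg"
    and \<theta> :: "('a \<times> 'a) set"
  assumes wfS: "wf_ids ar \<Sigma>"
    and V_nat: "\<forall>B::(nat,'f) alg. models ar \<Sigma> B \<longrightarrow> V_member_ok ar B"
    and V_a: "\<forall>B::('a,'f) alg. models ar \<Sigma> B \<longrightarrow> V_member_ok ar B"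
    and V_aset: "\<forall>B::('a set,'f) alg. models ar \<Sigma> B \<longrightarrow> V_member_ok ar B"
    and A_in_V: "models ar \<Sigma> A"
    and theta_cong: "\<theta> \<in> Con ar A"
    and theta_rad: "\<theta> \<subseteq> Rad ar A"
    and theta_CBLP: "CBLP ar A \<theta>"
    and quot_Bnormal: "B_normal ar (quot A \<theta>)"
  shows "B_normal ar A"
proof -
  have alg: "algebra ar A" using A_in_V by (simp add: models_def)
  have ok_a: "cong_modular ar C" "semidegenerate_alg ar C" if "models ar \<Sigma> C" for C :: "('a,'f) alg"
    using V_a[rule_format, OF that] by (simp_all add: V_member_ok_def)
  have ok_nat: "cong_modular ar C" "semidegenerate_alg ar C" if "models ar \<Sigma> C" for C :: "(nat,'f) alg"
    using V_nat[rule_format, OF that] by (simp_all add: V_member_ok_def)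
  have pairs: "shifting ar B \<and> collapsing ar B" if "models ar \<Sigma> B" for B :: "('a \<times> 'a,'f) alg"
    using square_embedding
  proof
    assume "\<exists>h :: 'a \<times> 'a \<Rightarrow> 'a. inj h"
    then obtain h :: "'a \<times> 'a \<Rightarrow> 'a" where "inj h" by blast
    then show ?thesis
      by (intro conjI inj_shifting[OF wfS _ _ that] inj_collapsing[OF wfS _ _ that])
         (simp_all add: ok_a)
  next
    assume "\<exists>h :: 'a \<times> 'a \<Rightarrow> nat. inj h"
    then obtain h :: "'a \<times> 'a \<Rightarrow> nat" where "inj h" by blast
    then show ?thesis
      by (intro conjI inj_shifting[OF wfS _ _ that] inj_collapsing[OF wfS _ _ that])
         (simp_all add: ok_nat)
  qed
  have R: "models ar \<Sigma> (rel_alg A \<beta>)" if "\<beta> \<in> Con ar A" for \<beta>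
    using models_rel_alg[OF A_in_V that] .
  have algR: "\<forall>\<beta>\<in>Con ar A. algebra ar (rel_alg A \<beta>)" using R by (simp add: models_def)
  have sh: "\<forall>\<beta>\<in>Con ar A. shifting ar (rel_alg A \<beta>)" using R pairs by blast
  have colR: "collapsing ar (rel_alg A (Nabla A))" using R[OF Nabla_Con[OF alg]] pairs by blast
  have col: "collapsing ar A"
    by (rule inj_collapsing[OF wfS ok_a(2) inj_on_id A_in_V])
  have max_above: "\<exists>\<phi>. max_cong ar A \<phi> \<and> \<gamma> \<subseteq> \<phi> \<and> \<theta> \<subseteq> \<phi>"
    if \<gamma>: "\<gamma> \<in> Con ar A" "\<gamma> \<noteq> Nabla A" for \<gamma>
  proof -
    obtain \<phi> where \<phi>: "max_cong ar A \<phi>" "\<gamma> \<subseteq> \<phi>"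
      by (rule ex_maximal_congruence[OF alg col \<gamma>])
    then have "Rad ar A \<subseteq> \<phi>" by (auto simp: Rad_def)
    then show ?thesis using theta_rad \<phi> by (intro exI[of _ \<phi>]) simp
  qed
  have algQ: "algebra ar (quot A \<theta>)" by (rule surj_hom_algebra[OF surj_hom_quot[OF theta_cong] alg])
  show ?thesis
    unfolding B_normal_def
  proof (intro ballI impI)
    fix \<chi> \<epsilon>
    assume C: "\<chi> \<in> Con ar A" "\<epsilon> \<in> Con ar A" and join: "cjoin ar A \<chi> \<epsilon> = Nabla A"
    let ?Q = "quot A \<theta>" and ?q = "\<lambda>\<gamma>. qcong \<theta> (cjoin ar A \<gamma> \<theta>)"
    have q: "?q \<gamma> \<in> Con ar ?Q" if "\<gamma> \<in> Con ar A" for \<gamma>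
      using that theta_cong by (intro qcong_Con cjoin_Con alg cjoin_upper)
    obtain \<beta>1 \<beta>2 where \<beta>: "\<beta>1 \<in> BCon ar ?Q" "\<beta>2 \<in> BCon ar ?Q"
      and j: "cjoin ar ?Q (?q \<chi>) \<beta>1 = Nabla ?Q" "cjoin ar ?Q (?q \<epsilon>) \<beta>2 = Nabla ?Q"
      and comm: "comm ar ?Q \<beta>1 \<beta>2 = Delta ?Q"
      using quot_Bnormal q[OF C(1)] q[OF C(2)] cjoin_qcong_Nabla[OF alg theta_cong C join]
      unfolding B_normal_def by blast
    obtain \<alpha>1 \<alpha>2 where \<alpha>: "\<alpha>1 \<in> BCon ar A" "\<alpha>2 \<in> BCon ar A" and \<beta>_eq: "?q \<alpha>1 = \<beta>1" "?q \<alpha>2 = \<beta>2"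
      using theta_CBLP[unfolded CBLP_def, THEN bspec, OF \<beta>(1)]
        theta_CBLP[unfolded CBLP_def, THEN bspec, OF \<beta>(2)] by (elim bexE)
    have \<alpha>C: "\<alpha>1 \<in> Con ar A" "\<alpha>2 \<in> Con ar A" using \<alpha> by (auto simp: BCon_def)
    \<comment> \<open>\<alpha>1 and \<alpha>2 are known to centralize each other only modulo
      \<theta>; a complement of \<alpha>1 meets it in \<open>Delta A\<close>, which gives a
      vanishing commutator in \<open>A\<close>.\<close>
    obtain \<gamma>1 where \<gamma>1: "\<gamma>1 \<in> Con ar A" "cjoin ar A \<alpha>1 \<gamma>1 = Nabla A" "\<alpha>1 \<inter> \<gamma>1 = Delta A"
      using \<alpha>(1) by (auto simp: BCon_def)
    have "cjoin ar A \<gamma>1 \<alpha>1 = Nabla A" "\<gamma>1 \<inter> \<alpha>1 = Delta A"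
      using \<gamma>1 by (auto simp: cjoin_def Un_commute)
    then have \<gamma>B: "\<gamma>1 \<in> BCon ar A" using \<gamma>1(1) \<alpha>C(1) unfolding BCon_def by blast
    have top1: "\<phi> = Nabla A" if "\<phi> \<in> Con ar A" "\<chi> \<subseteq> \<phi>" "\<theta> \<subseteq> \<phi>" "\<alpha>1 \<subseteq> \<phi>" for \<phi>
      using quot_join_Nabla[OF theta_cong, of \<chi> \<alpha>1] j(1) \<beta>_eq that by blast
    have top2: "\<phi> = Nabla A" if "\<phi> \<in> Con ar A" "\<epsilon> \<subseteq> \<phi>" "\<theta> \<subseteq> \<phi>" "\<alpha>2 \<subseteq> \<phi>" for \<phi>
      using quot_join_Nabla[OF theta_cong, of \<epsilon> \<alpha>2] j(2) \<beta>_eq that by blast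
    have "cjoin ar A \<chi> \<alpha>1 = Nabla A"
    proof (rule ccontr)
      assume "cjoin ar A \<chi> \<alpha>1 \<noteq> Nabla A"
      then obtain \<phi> where \<phi>: "max_cong ar A \<phi>" "cjoin ar A \<chi> \<alpha>1 \<subseteq> \<phi>" "\<theta> \<subseteq> \<phi>"
        using max_above cjoin_Con[OF alg] by blast
      have "\<phi> \<in> Con ar A" "\<phi> \<noteq> Nabla A" using \<phi>(1) by (auto simp: max_cong_def)
      moreover have "\<chi> \<subseteq> \<phi>" "\<alpha>1 \<subseteq> \<phi>" using \<phi>(2) cjoin_upper[OF C(1) \<alpha>C(1)] by auto
      ultimately show False using top1[of \<phi>] \<phi>(3) by simp
    qed
    moreover have "cjoin ar A \<epsilon> \<gamma>1 = Nabla A"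
    proof (rule ccontr)
      assume "cjoin ar A \<epsilon> \<gamma>1 \<noteq> Nabla A"
      then obtain \<phi> where \<phi>: "max_cong ar A \<phi>" "cjoin ar A \<epsilon> \<gamma>1 \<subseteq> \<phi>" "\<theta> \<subseteq> \<phi>"
        using max_above cjoin_Con[OF alg] by blast
      have \<phi>C: "\<phi> \<in> Con ar A" "\<phi> \<noteq> Nabla A" using \<phi>(1) by (auto simp: max_cong_def)
      have sub: "\<epsilon> \<subseteq> \<phi>" "\<gamma>1 \<subseteq> \<phi>" using \<phi>(2) cjoin_upper[OF C(2) \<gamma>1(1)] by auto
      let ?a = "cjoin ar A \<alpha>1 \<theta>" and ?b = "cjoin ar A \<alpha>2 \<theta>"
      have abC: "?a \<in> Con ar A" "?b \<in> Con ar A" using cjoin_Con[OF alg] by auto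
      have "centralizes ar ?Q (qcong \<theta> ?a) (qcong \<theta> ?b) (Delta ?Q)"
        using centralizes_comm[OF algQ q[OF \<alpha>C(1)] q[OF \<alpha>C(2)]] \<beta>_eq comm by simp
      then have "centralizes ar A ?a ?b \<theta>" by (rule centralizes_pullback[OF alg theta_cong abC])
      then have "?a \<subseteq> \<phi> \<or> ?b \<subseteq> \<phi>"
        using max_cong_prime[OF alg algR sh colR \<phi>(1) theta_cong \<phi>(3) abC] by blast
      then show False
      proof
        assume "?a \<subseteq> \<phi>"
        \<comment> \<open>\<phi> would contain \<alpha>1 together with its complement
          \<gamma>1.\<close>
        then have "\<alpha>1 \<subseteq> \<phi>" using cjoin_upper(1)[OF \<alpha>C(1) theta_cong] by blast
        then have "Nabla A \<subseteq> \<phi>" using cjoin_least[OF \<phi>C(1), of \<alpha>1 \<gamma>1] sub(2) \<gamma>1(2) by simp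
        then show False using Con_Nabla_subset[OF \<phi>C(1)] \<phi>C(2) by blast
      next
        assume "?b \<subseteq> \<phi>"
        \<comment> \<open>\<phi> would contain \<epsilon>, \<theta> and \<alpha>2, whose join is
          full.\<close>
        then have "\<alpha>2 \<subseteq> \<phi>" using cjoin_upper(1)[OF \<alpha>C(2) theta_cong] by blast
        then show False using top2[OF \<phi>C(1) sub(1) \<phi>(3)] \<phi>C(2) by blast
      qed
    qed
    moreover have "comm ar A \<alpha>1 \<gamma>1 = Delta A" using comm_disjoint[OF alg \<alpha>C(1) \<gamma>1(1,3)] .
    ultimately show "\<exists>\<alpha>\<in>BCon ar A. \<exists>\<beta>\<in>BCon ar A. cjoin ar A \<chi> \<alpha> = Nabla A \<and>
        cjoin ar A \<epsilon> \<beta> = Nabla A \<and> comm ar A \<alpha> \<beta> = Delta A"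
      using \<alpha>(1) \<gamma>B by blast
  qed
qed

end
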